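(* Let $m\ge 0$ be an integer, $c>0$ and $\eta>0$. Let $u$ be a $2\pi$-periodic (in $x$) solution of $u_{tt}=c^2u_{xx}$, and for each mesh width $h$ and time step $\Delta t$ let $p^n$, $n=0,\tfrac12,1,\dots$, be the approximation produced by the conservative Hermite method in one space dimension with periodic boundary conditions, with error $e^n(x)=u(x,t_n)-p^n(x)$, $t_n=n\Delta t$ (see context). Assume the CFL condition $c\Delta t<h$, and assume that the initial data $p^0,p^{1/2}$ are sufficiently accurate in the sense that, with a constant $C_0$ independent of $h$ and $\Delta t$, $$\|e^0\|\le C_0h^{2m+1},\qquad \|e^{1/2}\|\le C_0h^{2m+1},\qquad \mathcal E^{1/2}_{m+1}\le C_0h^{2m+2}.$$ Then for $u$ sufficiently smooth there exists $C$ independent of $h$ and of $\Delta t\ge c^{-1}\eta h$ such that for all $n$ $$\|e^n\|\le C h^{2m}(1+t_n^3).$$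
   Context: All functions of $x$ are $2\pi$-periodic; $\|\cdot\|$ is the $L^2$ norm on $[-\pi,\pi]$ and $|f|_{m+1}=\|d^{m+1}f/dx^{m+1}\|$. "Sufficiently smooth" means that $u$ has sufficiently many derivatives, the required number depending only on $m$; the constant $C$ may depend on $u$, $m$, $c$, $\eta$ and $C_0$. Grids: $h=2\pi/n_x$ with $n_x$ a positive integer, $x_i=-\pi+ih$; the primal grid consists of the nodes with integer $i$, the dual grid of the nodes with half-integer $i$ (indices periodic). At times $t_n=n\Delta t$ with integer $n$ data live on the primal grid; with half-integer $n$ they live on the dual grid. Hermite interpolation: $\mathcal I f$ is the piecewise polynomial that on each interval between consecutive nodes of the grid equals the unique polynomial of degree at most $2m+1$ whose derivatives of orders $0,\dots,m$ at both endpoints agree with those of $f$. $\mathcal I$ denotes this operator on the primal or on the dual grid, namely on the grid on which data live at the time level being computed. Half-step shifts: $(\mathcal S_\pm w)(x)=w\!\left(x\pm c\tfrac{\Delta t}{2}\right)$. Conservative Hermite method: given starting data $p^0$ and $p^{1/2}$, which are piecewise Hermite interpolants of degree $2m+1$ on the primal and dual grid respectively (i.e. in the range of the corresponding $\mathcal I$), set for $n=\tfrac12,1,\tfrac32,\dots$ $$p^{n+1/2}=\mathcal I\left(\mathcal S_+p^n+\mathcal S_-p^n\right)-p^{n-1/2}.$$ Conserved-variable errors: $E^n_\pm=e^n-\mathcal S_\pm e^{n-1/2}$ for $n\ge\tfrac12$, and $\mathcal E^n_{m+1}=|E^n_+|_{m+1}^2+|E^n_-|_{m+1}^2$. *)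

theory Defs
  imports "HOL-Analysis.Analysis" "HOL-Computational_Algebra.Polynomial"
begin

definition periodic_2pi :: "(real \<Rightarrow> real) \<Rightarrow> bool" where
  "periodic_2pi f \<longleftrightarrow> (\<forall>x. f (x + 2 * pi) = f x)"

definition l2norm :: "(real \<Rightarrow> real) \<Rightarrow> real" where
  "l2norm f = sqrt (set_lebesgue_integral lebesgue {-pi..pi} (\<lambda>x. (f x)\<^sup>2))"

text \<open>For a function of class \<open>C\<^sup>r\<^sup>-\<^sup>1\<close> that is piecewise \<open>C\<^sup>r\<close>, the arbitrary values of \<open>deriv\<close>
  at the finitely many break points in a period do not affect the integral.\<close>

definition seminorm :: "nat \<Rightarrow> (real \<Rightarrow> real) \<Rightarrow> real" where
  "seminorm r f = l2norm ((deriv ^^ r) f)"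

text \<open>A function \<open>u x t\<close> of class \<open>C\<^sup>K\<close> on \<open>t \<ge> 0\<close>; derivatives in \<open>t\<close> are one-sided at \<open>t = 0\<close>,
  and values at negative times are irrelevant.\<close>

primrec smooth_xt :: "nat \<Rightarrow> (real \<Rightarrow> real \<Rightarrow> real) \<Rightarrow> bool" where
  "smooth_xt 0 u \<longleftrightarrow> continuous_on (UNIV \<times> {0..}) (\<lambda>(x, t). u x t)"
| "smooth_xt (Suc K) u \<longleftrightarrow>
     continuous_on (UNIV \<times> {0..}) (\<lambda>(x, t). u x t) \<and>
     (\<exists>ux ut. (\<forall>x. \<forall>t\<ge>0. ((\<lambda>y. u y t) has_real_derivative ux x t) (at x)) \<and>
              (\<forall>x. \<forall>t\<ge>0. (u x has_real_derivative ut x t) (at t within {0..})) \<and>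
              smooth_xt K ux \<and> smooth_xt K ut)"

definition wave_solution :: "real \<Rightarrow> (real \<Rightarrow> real \<Rightarrow> real) \<Rightarrow> bool" where
  "wave_solution c u \<longleftrightarrow>
     (\<exists>ux uxx ut utt. \<forall>x. \<forall>t\<ge>0.
        ((\<lambda>y. u y t) has_real_derivative ux x t) (at x) \<and>
        ((\<lambda>y. ux y t) has_real_derivative uxx x t) (at x) \<and>
        (u x has_real_derivative ut x t) (at t within {0..}) \<and>
        (ut x has_real_derivative utt x t) (at t within {0..}) \<and>
        utt x t = c\<^sup>2 * uxx x t)"

text \<open>The half-integer time levels \<open>n = 0, 1/2, 1, \<dots>\<close> are encoded by natural numbers \<open>k = 2 n\<close>,
  so data live on the primal grid for even \<open>k\<close> and on the dual grid for odd \<open>k\<close>.\<close>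

definition time_level :: "real \<Rightarrow> nat \<Rightarrow> real" where
  "time_level dt k = real k / 2 * dt"

definition grid_offset :: "nat \<Rightarrow> real" where
  "grid_offset k = (if even k then 0 else 1 / 2)"

definition node :: "real \<Rightarrow> nat \<Rightarrow> int \<Rightarrow> real" where
  "node h k i = - pi + (of_int i + grid_offset k) * h"

definition hermite_poly :: "nat \<Rightarrow> real \<Rightarrow> real \<Rightarrow> (real \<Rightarrow> real) \<Rightarrow> real poly" where
  "hermite_poly m a b f =
     (THE q. degree q \<le> 2 * m + 1 \<and>
        (\<forall>j\<le>m. poly ((pderiv ^^ j) q) a = (deriv ^^ j) f a \<and>
               poly ((pderiv ^^ j) q) b = (deriv ^^ j) f b))"

text \<open>The floor picks the cell with \<open>node h k i \<le> x < node h k (i + 1)\<close>; at a node the polynomials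
  of the two adjacent cells agree.\<close>

definition hermite_interp :: "nat \<Rightarrow> real \<Rightarrow> nat \<Rightarrow> (real \<Rightarrow> real) \<Rightarrow> real \<Rightarrow> real" where
  "hermite_interp m h k f x =
     (let i = \<lfloor>(x + pi) / h - grid_offset k\<rfloor>
      in poly (hermite_poly m (node h k i) (node h k (i + 1)) f) x)"

definition hermite_range :: "nat \<Rightarrow> real \<Rightarrow> nat \<Rightarrow> (real \<Rightarrow> real) set" where
  "hermite_range m h k =
     hermite_interp m h k ` {f. periodic_2pi f \<and> (\<forall>j<m. (deriv ^^ j) f differentiable_on UNIV)}"

definition shift_plus :: "real \<Rightarrow> real \<Rightarrow> (real \<Rightarrow> real) \<Rightarrow> real \<Rightarrow> real" where
  "shift_plus c dt w x = w (x + c * (dt / 2))"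

definition shift_minus :: "real \<Rightarrow> real \<Rightarrow> (real \<Rightarrow> real) \<Rightarrow> real \<Rightarrow> real" where
  "shift_minus c dt w x = w (x - c * (dt / 2))"

definition conservative_hermite ::
  "nat \<Rightarrow> real \<Rightarrow> real \<Rightarrow> real \<Rightarrow> (nat \<Rightarrow> real \<Rightarrow> real) \<Rightarrow> bool" where
  "conservative_hermite m c h dt p \<longleftrightarrow>
     p 0 \<in> hermite_range m h 0 \<and> p 1 \<in> hermite_range m h 1 \<and>
     (\<forall>k\<ge>1. \<forall>x. p (k + 1) x =
        hermite_interp m h (k + 1) (\<lambda>y. shift_plus c dt (p k) y + shift_minus c dt (p k) y) x
        - p (k - 1) x)"

definition err ::
  "(real \<Rightarrow> real \<Rightarrow> real) \<Rightarrow> real \<Rightarrow> (nat \<Rightarrow> real \<Rightarrow> real) \<Rightarrow> nat \<Rightarrow> real \<Rightarrow> real" where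
  "err u dt p k x = u x (time_level dt k) - p k x"

text \<open>The conserved-variable errors are only meaningful for \<open>k \<ge> 1\<close>.\<close>

definition cerr_plus ::
  "(real \<Rightarrow> real \<Rightarrow> real) \<Rightarrow> real \<Rightarrow> real \<Rightarrow> (nat \<Rightarrow> real \<Rightarrow> real) \<Rightarrow> nat \<Rightarrow> real \<Rightarrow> real" where
  "cerr_plus u c dt p k x = err u dt p k x - shift_plus c dt (err u dt p (k - 1)) x"

definition cerr_minus ::
  "(real \<Rightarrow> real \<Rightarrow> real) \<Rightarrow> real \<Rightarrow> real \<Rightarrow> (nat \<Rightarrow> real \<Rightarrow> real) \<Rightarrow> nat \<Rightarrow> real \<Rightarrow> real" where
  "cerr_minus u c dt p k x = err u dt p k x - shift_minus c dt (err u dt p (k - 1)) x"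

definition err_energy ::
  "nat \<Rightarrow> (real \<Rightarrow> real \<Rightarrow> real) \<Rightarrow> real \<Rightarrow> real \<Rightarrow> (nat \<Rightarrow> real \<Rightarrow> real) \<Rightarrow> nat \<Rightarrow> real" where
  "err_energy r u c dt p k =
     (seminorm r (cerr_plus u c dt p k))\<^sup>2 + (seminorm r (cerr_minus u c dt p k))\<^sup>2"

end

theory Submission
  imports Defs
begin

text \<open>
  Let \<open>\<I>\<close> be the interpolation operator and \<open>\<delta>\<^sup>n = (1 - \<I>)(S\<^sub>+ p\<^sup>n + S\<^sub>- p\<^sup>n)\<close>. D'Alembert's identity for \<open>u\<close>
  gives \<open>e\<^sup>n\<^sup>+\<^sup>1\<^sup>/\<^sup>2 + e\<^sup>n\<^sup>-\<^sup>1\<^sup>/\<^sup>2 = S\<^sub>+ e\<^sup>n + S\<^sub>- e\<^sup>n + \<delta>\<^sup>n\<close>, so that the errors \<open>E\<^sub>\<plusminus>\<close> are transported along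
  characteristics with source \<open>\<delta>\<^sup>n\<close>. As \<open>1 - \<I>\<close> is orthogonal to all piecewise polynomials in the
  seminorm of order \<open>m + 1\<close>, the energy grows in one half step by exactly
  \<open>2 \<langle>\<delta>\<^sup>n, (1 - \<I>)(u\<^sup>n\<^sup>+\<^sup>1\<^sup>/\<^sup>2 - u\<^sup>n\<^sup>-\<^sup>1\<^sup>/\<^sup>2)\<rangle>\<close>. The time difference of \<open>u\<close> supplies an extra factor
  \<open>\<Delta>t\<close>, and \<open>\<delta>\<^sup>n\<close> is itself bounded by the square roots of the two energies; hence the square root of
  the energy is \<open>O(h\<^sup>m\<^sup>+\<^sup>1 (1 + t))\<close>. The iterated Poincare inequality turns this into
  \<open>\<parallel>\<delta>\<^sup>n\<parallel> = O(h\<^sup>2\<^sup>m\<^sup>+\<^sup>2 (1 + t))\<close>, and summing over the \<open>O(t / h)\<close> time steps once for \<open>E\<^sub>\<plusminus>\<close> and once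
  more for \<open>e\<close> costs the factor \<open>h\<^sup>-\<^sup>2 t\<^sup>2\<close>.
\<close>

section \<open>Two-point Hermite interpolation\<close>

lemma pderiv_funpow_Suc: "pderiv ((pderiv ^^ i) q) = (pderiv ^^ i) (pderiv q)"
  by (rule funpow_swap1)

text \<open>In characteristic zero, differentiation lowers the multiplicity of a root by exactly
  one, so the claim follows by induction on \<open>n\<close>. It turns Hermite conditions into
  divisibility conditions.\<close>

lemma dvd_power_iff_pderiv_zero:
  fixes q :: "real poly"
  shows "[:- a, 1:] ^ n dvd q \<longleftrightarrow> (\<forall>i<n. poly ((pderiv ^^ i) q) a = 0)"
proof (induction n arbitrary: q)
  case 0
  then show ?case by simp
next
  case (Suc n)
  have split: "(\<forall>i<Suc n. poly ((pderiv ^^ i) q) a = 0) \<longleftrightarrow>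
      poly q a = 0 \<and> (\<forall>i<n. poly ((pderiv ^^ i) (pderiv q)) a = 0)"
    by (auto simp: less_Suc_eq_0_disj pderiv_funpow_Suc)
  have "[:- a, 1:] ^ Suc n dvd q \<longleftrightarrow> poly q a = 0 \<and> [:- a, 1:] ^ n dvd pderiv q"
  proof
    assume "[:- a, 1:] ^ Suc n dvd q"
    then obtain r where r: "q = [:- a, 1:] ^ Suc n * r" by (elim dvdE)
    have "[:- a, 1:] ^ n dvd pderiv q"
      unfolding r pderiv_mult pderiv_power_Suc
      by (intro dvd_add dvd_mult2 dvd_mult dvd_smult dvd_refl le_imp_power_dvd) simp_all
    moreover have "poly q a = 0" by (simp add: r)
    ultimately show "poly q a = 0 \<and> [:- a, 1:] ^ n dvd pderiv q" by simp
  next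
    assume *: "poly q a = 0 \<and> [:- a, 1:] ^ n dvd pderiv q"
    show "[:- a, 1:] ^ Suc n dvd q"
    proof (cases "pderiv q = 0")
      case True
      then obtain c where "q = [:c:]"
        by (metis pderiv_eq_0_iff degree_eq_zeroE)
      then show ?thesis using * by simp
    next
      case False
      then have q0: "q \<noteq> 0" by auto
      then have "order a q \<noteq> 0" using * order_root[of q a] by simp
      then have "order a q = Suc (order a (pderiv q))"
        using False q0 * by (intro order_pderiv) simp_all
      moreover have "n \<le> order a (pderiv q)"
        using * False order_divides[of a n "pderiv q"] by simp
      ultimately show ?thesis by (metis Suc_le_mono order_divides)
    qed
  qed
  then show ?case using Suc.IH[of "pderiv q"] split by simp
qed

lemma pderiv_funpow_add: "(pderiv ^^ j) (p + q) = (pderiv ^^ j) p + (pderiv ^^ j) (q :: real poly)"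
  by (induction j) (simp_all add: pderiv_add)

lemma pderiv_funpow_diff: "(pderiv ^^ j) (p - q) = (pderiv ^^ j) p - (pderiv ^^ j) (q :: real poly)"
  by (induction j) (simp_all add: pderiv_diff)

lemma pderiv_funpow_smult: "(pderiv ^^ j) (smult c p) = smult c ((pderiv ^^ j) (p :: real poly))"
  by (induction j) (simp_all add: pderiv_smult)

lemma pderiv_funpow_eq_0:
  assumes "degree (q :: real poly) < j"
  shows "(pderiv ^^ j) q = 0"
  using assms
proof (induction j arbitrary: q)
  case (Suc j)
  show ?case
  proof (cases "degree q = 0")
    case True
    then have "pderiv q = 0" by (simp add: pderiv_eq_0_iff)
    moreover have "(pderiv ^^ i) (0 :: real poly) = 0" for i by (induction i) auto
    ultimately show ?thesis by (simp add: pderiv_funpow_Suc)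
  next
    case False
    then have "degree (pderiv q) < j" using Suc.prems by (simp add: degree_pderiv)
    then show ?thesis using Suc.IH by (simp add: pderiv_funpow_Suc)
  qed
qed auto

lemma linear_powers_mult_dvd:
  assumes "a \<noteq> (b :: real)" "q \<noteq> 0" "[:- a, 1:] ^ n dvd q" "[:- b, 1:] ^ k dvd q"
  shows "[:- a, 1:] ^ n * [:- b, 1:] ^ k dvd q"
proof -
  obtain r where r: "q = [:- a, 1:] ^ n * r" using assms(3) by (elim dvdE)
  have "order b ([:- a, 1:] ^ n) = 0"
    using assms(1) by (intro order_0I) simp
  then have "order b q = order b r"
    using assms(2) r order_mult[of "[:- a, 1:] ^ n" r b] by simp
  moreover have "k \<le> order b q"
    using assms(2,4) order_divides by metis
  ultimately have "[:- b, 1:] ^ k dvd r" by (metis order_divides)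
  then show ?thesis unfolding r by (rule mult_dvd_mono[OF dvd_refl])
qed

text \<open>Vanishing data force divisibility by \<open>(x - a)^(m+1)\<close> and by
  \<open>(x - b)^(m+1)\<close>. These factors are coprime, and their product has degree 2m + 2,
  which exceeds the degree allowed for \<open>q\<close>.\<close>

lemma hermite_data_zero_unique:
  fixes q :: "real poly"
  assumes "a \<noteq> b" "degree q \<le> 2 * m + 1"
    and "\<And>j. j \<le> m \<Longrightarrow> poly ((pderiv ^^ j) q) a = 0"
    and "\<And>j. j \<le> m \<Longrightarrow> poly ((pderiv ^^ j) q) b = 0"
  shows "q = 0"
proof (rule ccontr)
  assume "q \<noteq> 0"
  have "[:- a, 1:] ^ Suc m dvd q" "[:- b, 1:] ^ Suc m dvd q"
    unfolding dvd_power_iff_pderiv_zero using assms by auto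
  then have "[:- a, 1:] ^ Suc m * [:- b, 1:] ^ Suc m dvd q"
    by (rule linear_powers_mult_dvd[OF assms(1) \<open>q \<noteq> 0\<close>])
  then have "degree ([:- a, 1:] ^ Suc m * [:- b, 1:] ^ Suc m) \<le> degree q"
    using \<open>q \<noteq> 0\<close> by (intro dvd_imp_degree_le)
  moreover have "degree ([:- a, 1:] ^ Suc m * [:- b, 1:] ^ Suc m) = 2 * Suc m"
    by (subst degree_mult_eq) (simp_all add: degree_linear_power del: power_Suc)
  ultimately show False using assms(2) by simp
qed

text \<open>Newton's scheme: the data are matched one derivative at a time, each correction being a multiple
  of a polynomial that vanishes to exactly the order already reached.\<close>

lemma hermite_newton_step:
  fixes q w :: "real poly"
  assumes "[:- b, 1:] ^ n dvd w" "\<not> [:- b, 1:] ^ Suc n dvd w"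
  shows "\<exists>s. poly ((pderiv ^^ n) (q + smult s w)) b = y \<and>
    (\<forall>i<n. poly ((pderiv ^^ i) (q + smult s w)) b = poly ((pderiv ^^ i) q) b)"
proof -
  have z: "\<forall>i<n. poly ((pderiv ^^ i) w) b = 0"
    using assms(1) dvd_power_iff_pderiv_zero by blast
  moreover have "\<not> (\<forall>i<Suc n. poly ((pderiv ^^ i) w) b = 0)"
    using assms(2) dvd_power_iff_pderiv_zero by blast
  ultimately have "poly ((pderiv ^^ n) w) b \<noteq> 0" using less_Suc_eq by blast
  then show ?thesis
    using z by (intro exI[of _ "(y - poly ((pderiv ^^ n) q) b) / poly ((pderiv ^^ n) w) b"])
      (simp_all add: pderiv_funpow_add pderiv_funpow_smult)
qed

lemma hermite_exists_left:
  "\<exists>q :: real poly. degree q \<le> n \<and> (\<forall>j\<le>n. poly ((pderiv ^^ j) q) a = y j)"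
proof (induction n)
  case 0
  show ?case by (rule exI[of _ "[:y 0:]"]) simp
next
  case (Suc n)
  then obtain q where q: "degree q \<le> n" "\<forall>j\<le>n. poly ((pderiv ^^ j) q) a = y j" by blast
  let ?w = "[:- a, 1:] ^ Suc n"
  have "\<not> [:- a, 1:] ^ Suc (Suc n) dvd ?w"
  proof
    assume "[:- a, 1:] ^ Suc (Suc n) dvd ?w"
    then have "degree ([:- a, 1:] ^ Suc (Suc n)) \<le> degree ?w"
      by (rule dvd_imp_degree_le) (simp del: power_Suc)
    then show False by (simp add: degree_linear_power del: power_Suc)
  qed
  then obtain s where s: "poly ((pderiv ^^ Suc n) (q + smult s ?w)) a = y (Suc n)"
    "\<And>i. i < Suc n \<Longrightarrow> poly ((pderiv ^^ i) (q + smult s ?w)) a = poly ((pderiv ^^ i) q) a"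
    using hermite_newton_step[of a "Suc n" ?w q "y (Suc n)", OF dvd_refl] by blast
  have "degree (q + smult s ?w) \<le> Suc n"
    using q(1) by (intro degree_add_le order.trans[OF degree_smult_le])
      (simp_all add: degree_linear_power del: power_Suc)
  moreover have "\<forall>j\<le>Suc n. poly ((pderiv ^^ j) (q + smult s ?w)) a = y j"
    using s q(2) by (metis le_SucE le_imp_less_Suc)
  ultimately show ?case by blast
qed

lemma hermite_exists_right:
  assumes "a \<noteq> (b :: real)" "n \<le> Suc m"
  shows "\<exists>q :: real poly. degree q \<le> m + n \<and> (\<forall>j\<le>m. poly ((pderiv ^^ j) q) a = y j)
    \<and> (\<forall>j<n. poly ((pderiv ^^ j) q) b = z j)"
  using assms(2)
proof (induction n)
  case 0
  then show ?case using hermite_exists_left by simp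
next
  case (Suc n)
  then obtain q where q: "degree q \<le> m + n" "\<forall>j\<le>m. poly ((pderiv ^^ j) q) a = y j"
    "\<forall>j<n. poly ((pderiv ^^ j) q) b = z j" by auto
  \<comment> \<open>The factor of order m + 1 at \<open>a\<close> leaves the data already matched
    there unchanged. The factor at \<open>b\<close> has exact order \<open>n\<close>, so the next
    derivative at \<open>b\<close> can be adjusted freely.\<close>
  let ?w = "[:- b, 1:] ^ n * [:- a, 1:] ^ Suc m"
  have "\<not> [:- b, 1:] ^ Suc n dvd ?w"
  proof
    assume "[:- b, 1:] ^ Suc n dvd ?w"
    then have "[:- b, 1:] ^ n * [:- b, 1:] dvd ?w" by (simp add: mult.commute)
    then have "[:- b, 1:] dvd [:- a, 1:] ^ Suc m" by (subst (asm) dvd_mult_cancel_left) simp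
    then have "poly ([:- a, 1:] ^ Suc m) b = 0" by (metis dvd_iff_poly_eq_0 minus_minus)
    then show False using assms(1) by simp
  qed
  then obtain s where s: "poly ((pderiv ^^ n) (q + smult s ?w)) b = z n"
    "\<And>i. i < n \<Longrightarrow> poly ((pderiv ^^ i) (q + smult s ?w)) b = poly ((pderiv ^^ i) q) b"
    using hermite_newton_step[of b n ?w q "z n", OF dvd_triv_left] by blast
  have "\<forall>i<Suc m. poly ((pderiv ^^ i) ?w) a = 0"
    by (subst dvd_power_iff_pderiv_zero[symmetric]) (rule dvd_triv_right)
  then have "\<forall>j\<le>m. poly ((pderiv ^^ j) (q + smult s ?w)) a = y j"
    using q(2) by (simp add: pderiv_funpow_add pderiv_funpow_smult)
  moreover have "degree (q + smult s ?w) \<le> m + Suc n"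
    using q(1) by (intro degree_add_le order.trans[OF degree_smult_le] order.trans[OF degree_mult_le])
      (simp_all add: degree_linear_power del: power_Suc)
  moreover have "\<forall>j<Suc n. poly ((pderiv ^^ j) (q + smult s ?w)) b = z j"
    using s q(3) less_Suc_eq by simp
  ultimately show ?case by blast
qed

text \<open>Existence comes from the Newton construction with m + 1 conditions at each end, and
  uniqueness from \<open>hermite_data_zero_unique\<close>. Together they justify the definite
  description in \<open>hermite_poly\<close>.\<close>

lemma
  assumes "a \<noteq> b"
  shows degree_hermite_poly: "degree (hermite_poly m a b f) \<le> 2 * m + 1"
    and hermite_poly_left: "\<And>j. j \<le> m \<Longrightarrow> poly ((pderiv ^^ j) (hermite_poly m a b f)) a = (deriv ^^ j) f a"
    and hermite_poly_right: "\<And>j. j \<le> m \<Longrightarrow> poly ((pderiv ^^ j) (hermite_poly m a b f)) b = (deriv ^^ j) f b"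
proof -
  let ?P = "\<lambda>q. degree q \<le> 2 * m + 1 \<and>
        (\<forall>j\<le>m. poly ((pderiv ^^ j) q) a = (deriv ^^ j) f a \<and>
               poly ((pderiv ^^ j) q) b = (deriv ^^ j) f b)"
  have "\<exists>!q. ?P q"
  proof (rule ex_ex1I)
    show "\<exists>q. ?P q"
      using hermite_exists_right[OF assms, of "Suc m" m "\<lambda>j. (deriv ^^ j) f a" "\<lambda>j. (deriv ^^ j) f b"]
      by (auto simp: less_Suc_eq_le mult_2)
  next
    fix q r assume qr: "?P q" "?P r"
    have "q - r = 0"
      using qr by (intro hermite_data_zero_unique[OF assms, of _ m] degree_diff_le)
        (auto simp: pderiv_funpow_diff)
    then show "q = r" by simp
  qed
  from theI'[OF this] have "?P (hermite_poly m a b f)" unfolding hermite_poly_def .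
  then show "degree (hermite_poly m a b f) \<le> 2 * m + 1"
    "\<And>j. j \<le> m \<Longrightarrow> poly ((pderiv ^^ j) (hermite_poly m a b f)) a = (deriv ^^ j) f a"
    "\<And>j. j \<le> m \<Longrightarrow> poly ((pderiv ^^ j) (hermite_poly m a b f)) b = (deriv ^^ j) f b"
    by auto
qed

section \<open>Inner products of locally bounded functions\<close>

text \<open>Derivatives of order m + 1 of piecewise polynomials jump at nodes, so continuity is too
  strong a requirement. This class contains them, is closed under products and shifts, and
  guarantees integrability on bounded intervals.\<close>

definition loc_bdd_meas :: "(real \<Rightarrow> real) \<Rightarrow> bool" where
  "loc_bdd_meas f \<longleftrightarrow> f \<in> borel_measurable borel \<and> (\<forall>a b. bounded (f ` {a..b}))"

definition ip :: "real \<Rightarrow> real \<Rightarrow> (real \<Rightarrow> real) \<Rightarrow> (real \<Rightarrow> real) \<Rightarrow> real" where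
  "ip a b f g = integral {a..b} (\<lambda>x. f x * g x)"

lemma loc_bdd_meas_cont: "continuous_on UNIV f \<Longrightarrow> loc_bdd_meas f"
  unfolding loc_bdd_meas_def
  by (auto intro!: borel_measurable_continuous_onI compact_imp_bounded compact_continuous_image
      intro: continuous_on_subset)

lemma loc_bdd_meas_add: "loc_bdd_meas f \<Longrightarrow> loc_bdd_meas g \<Longrightarrow> loc_bdd_meas (\<lambda>x. f x + g x)"
  unfolding loc_bdd_meas_def by (auto intro: bounded_plus_comp)

lemma loc_bdd_meas_diff: "loc_bdd_meas f \<Longrightarrow> loc_bdd_meas g \<Longrightarrow> loc_bdd_meas (\<lambda>x. f x - g x)"
  unfolding loc_bdd_meas_def by (auto intro: bounded_minus_comp)

lemma loc_bdd_meas_const: "loc_bdd_meas (\<lambda>x. c)"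
  by (intro loc_bdd_meas_cont continuous_intros)

lemma loc_bdd_meas_mult:
  assumes "loc_bdd_meas f" "loc_bdd_meas g"
  shows "loc_bdd_meas (\<lambda>x. f x * g x)"
proof -
  have "bounded ((\<lambda>x. f x * g x) ` {a..b})" for a b
  proof -
    obtain B C where "\<forall>x\<in>{a..b}. norm (f x) \<le> B" "\<forall>x\<in>{a..b}. norm (g x) \<le> C"
      using assms unfolding loc_bdd_meas_def bounded_iff by (metis imageI)
    then have "\<forall>x\<in>{a..b}. norm (f x * g x) \<le> B * C"
      by (metis mult_mono norm_ge_zero norm_mult order_trans)
    then show ?thesis unfolding bounded_iff by blast
  qed
  then show ?thesis using assms unfolding loc_bdd_meas_def by auto
qed

lemma loc_bdd_meas_shift:
  assumes "loc_bdd_meas f"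
  shows "loc_bdd_meas (\<lambda>x. f (x + s))"
proof -
  have "bounded ((\<lambda>x. f (x + s)) ` {a..b})" for a b
    using assms bounded_subset[of "f ` {a + s..b + s}" "(\<lambda>x. f (x + s)) ` {a..b}"]
    unfolding loc_bdd_meas_def by fastforce
  moreover have "(\<lambda>x. f (x + s)) \<in> borel_measurable borel"
    using assms unfolding loc_bdd_meas_def by (auto intro: measurable_compose[rotated])
  ultimately show ?thesis unfolding loc_bdd_meas_def by blast
qed

lemma loc_bdd_meas_set_integrable:
  assumes "loc_bdd_meas f"
  shows "set_integrable lborel {a..b} f"
proof -
  obtain B where B: "\<And>x. x \<in> {a..b} \<Longrightarrow> norm (f x) \<le> B"
    using assms unfolding loc_bdd_meas_def bounded_iff by (metis imageI)
  have [measurable]: "f \<in> borel_measurable borel" using assms by (simp add: loc_bdd_meas_def)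
  show ?thesis
  proof (rule set_integrable_bound[of lborel _ "\<lambda>x. B"])
    show "set_integrable lborel {a..b} (\<lambda>x. B)"
      by (intro borel_integrable_atLeastAtMost' continuous_on_const)
    show "set_borel_measurable lborel {a..b} f"
      unfolding set_borel_measurable_def by measurable
  qed (use B in \<open>force intro!: AE_I2\<close>)
qed

lemma loc_bdd_meas_integrable: "loc_bdd_meas f \<Longrightarrow> f integrable_on {a..b}"
  using loc_bdd_meas_set_integrable set_borel_integral_eq_integral(1) by blast

lemma ip_integrable:
  "loc_bdd_meas f \<Longrightarrow> loc_bdd_meas g \<Longrightarrow> (\<lambda>x. f x * g x) integrable_on {a..b}"
  by (intro loc_bdd_meas_integrable loc_bdd_meas_mult)

lemma ip_commute: "ip a b f g = ip a b g f"
  by (simp add: ip_def mult.commute)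

lemma ip_add_left:
  assumes "loc_bdd_meas f" "loc_bdd_meas g" "loc_bdd_meas w"
  shows "ip a b (\<lambda>x. f x + g x) w = ip a b f w + ip a b g w"
  unfolding ip_def using ip_integrable assms
  by (simp add: distrib_right integral_add)

lemma ip_diff_left:
  assumes "loc_bdd_meas f" "loc_bdd_meas g" "loc_bdd_meas w"
  shows "ip a b (\<lambda>x. f x - g x) w = ip a b f w - ip a b g w"
  unfolding ip_def using ip_integrable assms
  by (simp add: left_diff_distrib integral_diff)

lemma ip_add_right:
  assumes "loc_bdd_meas f" "loc_bdd_meas g" "loc_bdd_meas w"
  shows "ip a b w (\<lambda>x. f x + g x) = ip a b w f + ip a b w g"
  using ip_add_left[OF assms] by (simp add: ip_commute)

lemma ip_diff_right:
  assumes "loc_bdd_meas f" "loc_bdd_meas g" "loc_bdd_meas w"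
  shows "ip a b w (\<lambda>x. f x - g x) = ip a b w f - ip a b w g"
  using ip_diff_left[OF assms] by (simp add: ip_commute)

lemma ip_cmult_left: "ip a b (\<lambda>x. c * f x) g = c * ip a b f g"
  unfolding ip_def by (simp add: mult.assoc)

lemma ip_self_nonneg: "loc_bdd_meas f \<Longrightarrow> ip a b f f \<ge> 0"
  unfolding ip_def by (intro integral_nonneg ip_integrable) auto

lemma ip_cauchy_schwarz:
  assumes f: "loc_bdd_meas f" and g: "loc_bdd_meas g"
  shows "(ip a b f g)\<^sup>2 \<le> ip a b f f * ip a b g g"
proof -
  let ?F = "ip a b f f" and ?G = "ip a b g g" and ?C = "ip a b f g"
  have q: "?F - 2 * s * ?C + s\<^sup>2 * ?G \<ge> 0" for s
  proof -
    have sg: "loc_bdd_meas (\<lambda>x. s * g x)"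
      by (intro loc_bdd_meas_mult loc_bdd_meas_const g)
    have "ip a b (\<lambda>x. f x - s * g x) (\<lambda>x. f x - s * g x) = ?F - 2 * s * ?C + s\<^sup>2 * ?G"
      by (simp add: ip_diff_left ip_diff_right f sg loc_bdd_meas_diff)
         (simp add: ip_commute[of a b f] ip_cmult_left ip_commute[of a b g "\<lambda>x. s * g x"]
           power2_eq_square)
    then show ?thesis
      using ip_self_nonneg[OF loc_bdd_meas_diff[OF f sg]] by metis
  qed
  show ?thesis
  proof (cases "?G = 0")
    case True
    have "?C = 0"
    proof (rule ccontr)
      assume "?C \<noteq> 0"
      \<comment> \<open>If the quadratic term vanishes, the expression is affine in
        \<open>s\<close>; this choice of \<open>s\<close> gives it the value -1.\<close>
      then show False using q[of "(?F + 1) / (2 * ?C)"] True by simp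
    qed
    then show ?thesis using True by simp
  next
    case False
    then have "?G > 0" using ip_self_nonneg[OF g, of a b] by simp
    \<comment> \<open>This is the minimiser of the quadratic in \<open>s\<close>.\<close>
    then show ?thesis using q[of "?C / ?G"] by (simp add: field_simps power2_eq_square)
  qed
qed

section \<open>The norm of the inner product and integration over a full period\<close>

definition nrm :: "real \<Rightarrow> real \<Rightarrow> (real \<Rightarrow> real) \<Rightarrow> real" where
  "nrm a b f = sqrt (ip a b f f)"

lemma nrm_nonneg: "loc_bdd_meas f \<Longrightarrow> nrm a b f \<ge> 0"
  by (simp add: nrm_def ip_self_nonneg)

lemma nrm_sq: "loc_bdd_meas f \<Longrightarrow> (nrm a b f)\<^sup>2 = ip a b f f"
  by (simp add: nrm_def ip_self_nonneg)

lemma abs_ip_le_nrm: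
  assumes "loc_bdd_meas f" "loc_bdd_meas g"
  shows "\<bar>ip a b f g\<bar> \<le> nrm a b f * nrm a b g"
proof -
  have "\<bar>ip a b f g\<bar>\<^sup>2 \<le> (nrm a b f * nrm a b g)\<^sup>2"
    using ip_cauchy_schwarz[OF assms] by (simp add: power_mult_distrib nrm_sq assms)
  then show ?thesis
    using abs_le_square_iff nrm_nonneg assms by (metis abs_abs abs_of_nonneg mult_nonneg_nonneg)
qed

lemma nrm_triangle:
  assumes "loc_bdd_meas f" "loc_bdd_meas g"
  shows "nrm a b (\<lambda>x. f x + g x) \<le> nrm a b f + nrm a b g"
proof (rule power2_le_imp_le)
  have "(nrm a b (\<lambda>x. f x + g x))\<^sup>2 = (nrm a b f)\<^sup>2 + 2 * ip a b f g + (nrm a b g)\<^sup>2"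
    by (simp add: nrm_sq loc_bdd_meas_add assms ip_add_left ip_add_right ip_commute[of a b g f])
  also have "\<dots> \<le> (nrm a b f + nrm a b g)\<^sup>2"
    using abs_ip_le_nrm[OF assms, of a b] by (simp add: power2_sum)
  finally show "(nrm a b (\<lambda>x. f x + g x))\<^sup>2 \<le> (nrm a b f + nrm a b g)\<^sup>2" .
qed (simp add: nrm_nonneg assms)

lemma nrm_triangle_diff:
  assumes "loc_bdd_meas f" "loc_bdd_meas g"
  shows "nrm a b (\<lambda>x. f x - g x) \<le> nrm a b f + nrm a b g"
proof -
  have "nrm a b (\<lambda>x. - 1 * g x) = nrm a b g"
    by (simp add: nrm_def ip_def)
  then show ?thesis
    using nrm_triangle[OF assms(1) loc_bdd_meas_mult[OF loc_bdd_meas_const assms(2)], of a b "- 1"]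
    by simp
qed

lemma ip_combine:
  assumes "a \<le> c" "c \<le> b" "loc_bdd_meas f" "loc_bdd_meas g"
  shows "ip a b f g = ip a c f g + ip c b f g"
  unfolding ip_def using Henstock_Kurzweil_Integration.integral_combine[OF assms(1,2) ip_integrable[OF assms(3,4)]] by simp

lemma ip_periodic:
  assumes f: "loc_bdd_meas f" "periodic_2pi f" and g: "loc_bdd_meas g" "periodic_2pi g"
  shows "ip a (a + 2 * pi) f g = ip (- pi) pi f g"
proof -
  have shift: "ip (c + 2 * pi) (d + 2 * pi) f g = ip c d f g" for c d
  proof -
    have "ip c d f g = integral {c..d} (\<lambda>x. (\<lambda>x. f x * g x) (x + 2 * pi))"
      using f(2) g(2) by (simp add: ip_def periodic_2pi_def)
    then show ?thesis
      using integral_shift_cbox[of "c + 2 * pi" "2 * pi" "d + 2 * pi" "\<lambda>x. f x * g x"]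
      by (simp add: ip_def)
  qed
  \<comment> \<open>The interval from \<open>c\<close> to d + 2 pi is split once at \<open>d\<close>
    and once at c + 2 pi; by periodicity the outer pieces agree, hence so do the two full
    periods.\<close>
  have *: "ip c (c + 2 * pi) f g = ip d (d + 2 * pi) f g" if "c \<le> d" for c d
    using ip_combine[of c d "d + 2 * pi" f g] ip_combine[of c "c + 2 * pi" "d + 2 * pi" f g]
      shift[of c d] f g that by simp
  show ?thesis
    using *[of a "- pi"] *[of "- pi" a] by (cases "a \<le> - pi") auto
qed

lemma ip_shift:
  assumes f: "loc_bdd_meas f" "periodic_2pi f" and g: "loc_bdd_meas g" "periodic_2pi g"
  shows "ip (- pi) pi (\<lambda>x. f (x + s)) (\<lambda>x. g (x + s)) = ip (- pi) pi f g"
proof -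
  have "ip (- pi) pi (\<lambda>x. f (x + s)) (\<lambda>x. g (x + s)) = ip (- pi + s) (pi + s) f g"
    using integral_shift_cbox[of "- pi + s" s "pi + s" "\<lambda>x. f x * g x"]
    by (simp add: ip_def)
  also have "\<dots> = ip (- pi) pi f g"
    using ip_periodic[OF assms, of "- pi + s"] by (simp add: algebra_simps)
  finally show ?thesis .
qed

lemma nrm_shift:
  assumes "loc_bdd_meas f" "periodic_2pi f"
  shows "nrm (- pi) pi (\<lambda>x. f (x + s)) = nrm (- pi) pi f"
  by (simp add: nrm_def ip_shift assms)

lemma ip_cong_finite:
  assumes "finite S" "\<And>x. x \<in> {a..b} - S \<Longrightarrow> f x = f' x" "\<And>x. x \<in> {a..b} - S \<Longrightarrow> g x = g' x"
  shows "ip a b f g = ip a b f' g'"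
  unfolding ip_def using assms by (intro integral_spike[of S] negligible_finite) auto

text \<open>Links the Lebesgue integral of the problem statement to the gauge integral used in
  \<open>ip\<close>. The finite exceptional set absorbs the arbitrary values of \<open>deriv\<close>
  at break points.\<close>

lemma l2norm_eq_nrm:
  assumes "loc_bdd_meas f" "finite S" "\<And>x. x \<in> {- pi..pi} - S \<Longrightarrow> g x = f x"
  shows "l2norm g = nrm (- pi) pi f"
proof -
  have "set_integrable lebesgue {- pi..pi} (\<lambda>x. f x * f x)"
    using loc_bdd_meas_set_integrable[OF loc_bdd_meas_mult[OF assms(1,1)], of "- pi" pi]
    unfolding set_integrable_def by (intro integrable_completion[THEN iffD2]) auto
  then have "set_integrable lebesgue {- pi..pi} (\<lambda>x. (g x)\<^sup>2)"
    by (rule absolutely_integrable_spike[OF _ negligible_finite[OF assms(2)]])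
       (simp add: assms(3) power2_eq_square)
  then have "set_lebesgue_integral lebesgue {- pi..pi} (\<lambda>x. (g x)\<^sup>2) = integral {- pi..pi} (\<lambda>x. (g x)\<^sup>2)"
    by (rule set_lebesgue_integral_eq_integral(2))
  also have "\<dots> = ip (- pi) pi f f"
    unfolding ip_def
    by (rule integral_spike[OF negligible_finite[OF assms(2)]]) (simp add: assms(3) power2_eq_square)
  finally show ?thesis by (simp add: l2norm_def nrm_def)
qed

text \<open>As \<open>f\<close> vanishes at the left end, it is the integral of \<open>g\<close>;
  Cauchy-Schwarz against the constant 1 bounds its square pointwise by \<open>b - a\<close> times
  the integral of the square of \<open>g\<close>. Integrating once more gives the second factor
  \<open>b - a\<close>.\<close>

lemma poincare_cell:
  assumes ab: "a \<le> b" and S: "finite S" and cont: "continuous_on {a..b} f" and "f a = 0"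
    and deriv: "\<And>x. x \<in> {a<..<b} - S \<Longrightarrow> (f has_real_derivative g x) (at x)"
    and f: "loc_bdd_meas f" and g: "loc_bdd_meas g"
  shows "ip a b f f \<le> (b - a)\<^sup>2 * ip a b g g"
proof -
  have "f x * f x \<le> (b - a) * ip a b g g" if x: "x \<in> {a..b}" for x
  proof -
    have "(g has_integral (f x - f a)) {a..x}"
    proof (rule fundamental_theorem_of_calculus_interior_strong[OF S])
      show "(f has_vector_derivative g y) (at y)" if "y \<in> {a<..<x} - S" for y
        using deriv[of y] that x by (auto simp: has_real_derivative_iff_has_vector_derivative)
      show "continuous_on {a..x} f" using x by (intro continuous_on_subset[OF cont]) auto
    qed (use x in auto)
    then have fx: "f x = ip a x (\<lambda>x. 1) g"
      using \<open>f a = 0\<close> by (simp add: ip_def integral_unique)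
    have "(f x)\<^sup>2 \<le> ip a x (\<lambda>x. 1) (\<lambda>x. 1) * ip a x g g"
      unfolding fx by (rule ip_cauchy_schwarz[OF loc_bdd_meas_const g])
    also have "ip a x (\<lambda>x. 1) (\<lambda>x. 1) = x - a"
      using x by (simp add: ip_def)
    also have "(x - a) * ip a x g g \<le> (b - a) * ip a b g g"
      using x ip_combine[of a x b g g] g ip_self_nonneg[OF g]
      by (intro mult_mono) auto
    finally show ?thesis by (simp add: power2_eq_square)
  qed
  then have "ip a b f f \<le> integral {a..b} (\<lambda>x. (b - a) * ip a b g g)"
    unfolding ip_def[of a b f] by (intro integral_le ip_integrable f integrable_const_ivl) auto
  also have "\<dots> = (b - a)\<^sup>2 * ip a b g g"
    using ab by (simp add: power2_eq_square)
  finally show ?thesis .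
qed

lemma ip_by_parts:
  assumes ab: "a \<le> b" and S: "finite S" and cont: "continuous_on {a..b} f" and "f a = 0" "f b = 0"
    and deriv: "\<And>x. x \<in> {a<..<b} - S \<Longrightarrow> (f has_real_derivative f' x) (at x)"
    and f: "loc_bdd_meas f" and f': "loc_bdd_meas f'"
    and g: "\<And>x. (g has_real_derivative g' x) (at x)" and g': "loc_bdd_meas g'"
  shows "ip a b f' g = - ip a b f g'"
proof -
  have gc: "continuous_on UNIV g"
    using g by (auto intro!: continuous_at_imp_continuous_on DERIV_isCont)
  note gm = loc_bdd_meas_cont[OF gc]
  have "((\<lambda>x. f' x * g x + f x * g' x) has_integral (f b * g b - f a * g a)) {a..b}"
  proof (rule fundamental_theorem_of_calculus_interior_strong[OF S ab])
    show "((\<lambda>x. f x * g x) has_vector_derivative f' y * g y + f y * g' y) (at y)"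
      if "y \<in> {a<..<b} - S" for y
      unfolding has_real_derivative_iff_has_vector_derivative[symmetric]
      by (rule derivative_eq_intros deriv[OF that] g refl)+ simp
    show "continuous_on {a..b} (\<lambda>x. f x * g x)"
      by (intro continuous_intros cont continuous_on_subset[OF gc]) auto
  qed
  then have "integral {a..b} (\<lambda>x. f' x * g x + f x * g' x) = 0"
    using \<open>f a = 0\<close> \<open>f b = 0\<close> by (simp add: integral_unique)
  then show ?thesis
    unfolding ip_def using integral_add[OF ip_integrable[OF f' gm] ip_integrable[OF f g']]
    by simp
qed

section \<open>Jets and piecewise Hermite interpolation\<close>

definition locally_finite :: "real set \<Rightarrow> bool" where
  "locally_finite S \<longleftrightarrow> (\<forall>a b. finite (S \<inter> {a..b}))"

lemma locally_finite_Un: "locally_finite S \<Longrightarrow> locally_finite T \<Longrightarrow> locally_finite (S \<union> T)"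
  by (simp add: locally_finite_def Int_Un_distrib2)

lemma locally_finite_shift:
  assumes "locally_finite S"
  shows "locally_finite {x. x + s \<in> S}"
proof -
  have "finite ({x. x + s \<in> S} \<inter> {a..b})" for a b
  proof -
    have "{x. x + s \<in> S} \<inter> {a..b} \<subseteq> (\<lambda>x. x - s) ` (S \<inter> {a + s..b + s})"
      by (force simp: image_iff)
    then show ?thesis using assms finite_surj unfolding locally_finite_def by blast
  qed
  then show ?thesis by (simp add: locally_finite_def)
qed

lemma periodic_2pi_deriv:
  assumes "periodic_2pi f"
  shows "periodic_2pi (deriv f)"
proof -
  have "(\<lambda>x. f (x + 2 * pi)) = f" using assms by (auto simp: periodic_2pi_def)
  then show ?thesis by (simp add: periodic_2pi_def deriv_def DERIV_shift)
qed

lemma periodic_2pi_funpow_deriv: "periodic_2pi f \<Longrightarrow> periodic_2pi ((deriv ^^ j) f)"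
  by (induction j) (auto intro: periodic_2pi_deriv)

text \<open>A jet carries a function together with its derivatives up to order \<open>m\<close> and, up to
  a locally finite set, its derivative of order \<open>m + 1\<close>. Unlike for iterated \<open>deriv\<close>,
  linear identities then hold at every point.\<close>

definition jet :: "nat \<Rightarrow> (nat \<Rightarrow> real \<Rightarrow> real) \<Rightarrow> bool" where
  "jet m F \<longleftrightarrow>
     (\<forall>j<m. \<forall>x. (F j has_real_derivative F (Suc j) x) (at x)) \<and>
     continuous_on UNIV (F m) \<and>
     (\<exists>S. locally_finite S \<and> (\<forall>x. x \<notin> S \<longrightarrow> (F m has_real_derivative F (Suc m) x) (at x))) \<and>
     (\<forall>j\<le>Suc m. periodic_2pi (F j)) \<and> loc_bdd_meas (F (Suc m))"

lemma jet_cont: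
  assumes "jet m F" "j \<le> m"
  shows "continuous_on UNIV (F j)"
proof (cases "j = m")
  case False
  then have "\<And>x. isCont (F j) x"
    using assms unfolding jet_def by (metis DERIV_isCont le_neq_implies_less)
  then show ?thesis by (simp add: continuous_at_imp_continuous_on)
qed (use assms in \<open>simp add: jet_def\<close>)

lemma jet_loc_bdd_meas: "jet m F \<Longrightarrow> j \<le> Suc m \<Longrightarrow> loc_bdd_meas (F j)"
  using jet_cont loc_bdd_meas_cont unfolding jet_def by (metis le_SucE)

lemma jet_periodic: "jet m F \<Longrightarrow> j \<le> Suc m \<Longrightarrow> periodic_2pi (F j)"
  by (simp add: jet_def)

lemma jet_add:
  assumes F: "jet m F" and G: "jet m G"
  shows "jet m (\<lambda>j x. F j x + G j x)"
proof -
  obtain S T where S: "locally_finite S" "\<And>x. x \<notin> S \<Longrightarrow> (F m has_real_derivative F (Suc m) x) (at x)"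
    and T: "locally_finite T" "\<And>x. x \<notin> T \<Longrightarrow> (G m has_real_derivative G (Suc m) x) (at x)"
    using F G unfolding jet_def by blast
  have "\<exists>S. locally_finite S \<and>
      (\<forall>x. x \<notin> S \<longrightarrow> ((\<lambda>x. F m x + G m x) has_real_derivative F (Suc m) x + G (Suc m) x) (at x))"
    using S T by (intro exI[of _ "S \<union> T"]) (auto intro!: DERIV_add locally_finite_Un)
  then show ?thesis
    using F G unfolding jet_def
    by (auto intro!: DERIV_add continuous_on_add loc_bdd_meas_add simp: periodic_2pi_def)
qed

lemma jet_diff:
  assumes F: "jet m F" and G: "jet m G"
  shows "jet m (\<lambda>j x. F j x - G j x)"
proof -
  obtain S T where S: "locally_finite S" "\<And>x. x \<notin> S \<Longrightarrow> (F m has_real_derivative F (Suc m) x) (at x)"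
    and T: "locally_finite T" "\<And>x. x \<notin> T \<Longrightarrow> (G m has_real_derivative G (Suc m) x) (at x)"
    using F G unfolding jet_def by blast
  have "\<exists>S. locally_finite S \<and>
      (\<forall>x. x \<notin> S \<longrightarrow> ((\<lambda>x. F m x - G m x) has_real_derivative F (Suc m) x - G (Suc m) x) (at x))"
    using S T by (intro exI[of _ "S \<union> T"]) (auto intro!: DERIV_diff locally_finite_Un)
  then show ?thesis
    using F G unfolding jet_def
    by (auto intro!: DERIV_diff continuous_on_diff loc_bdd_meas_diff simp: periodic_2pi_def)
qed

lemma jet_shift:
  assumes F: "jet m F"
  shows "jet m (\<lambda>j x. F j (x + s))"
proof -
  obtain S where S: "locally_finite S" "\<And>x. x \<notin> S \<Longrightarrow> (F m has_real_derivative F (Suc m) x) (at x)"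
    using F unfolding jet_def by blast
  have "\<exists>S. locally_finite S \<and>
      (\<forall>x. x \<notin> S \<longrightarrow> ((\<lambda>x. F m (x + s)) has_real_derivative F (Suc m) (x + s)) (at x))"
    using S by (intro exI[of _ "{x. x + s \<in> S}"])
      (auto intro!: locally_finite_shift DERIV_shift[THEN iffD1])
  moreover have "continuous_on UNIV (\<lambda>x. F m (x + s))"
    using F unfolding jet_def by (auto intro!: continuous_on_compose2[of UNIV "F m"] continuous_intros)
  moreover have "periodic_2pi (\<lambda>x. F j (x + s))" if "j \<le> Suc m" for j
    using jet_periodic[OF F that] unfolding periodic_2pi_def by (metis add.assoc add.commute)
  ultimately show ?thesis
    using F unfolding jet_def
    by (auto intro!: loc_bdd_meas_shift DERIV_shift[THEN iffD1])
qed

lemma jet_funpow_deriv: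
  assumes "jet m F" "j \<le> m"
  shows "(deriv ^^ j) (F 0) = F j"
  using assms(2)
proof (induction j)
  case (Suc j)
  then have "\<And>x. (F j has_real_derivative F (Suc j) x) (at x)"
    using assms(1) by (simp add: jet_def)
  then show ?case using Suc by (auto intro: DERIV_imp_deriv)
qed auto

lemma seminorm_jet:
  assumes F: "jet m F"
  shows "seminorm (m + 1) (F 0) = nrm (- pi) pi (F (Suc m))"
proof -
  obtain S where S: "locally_finite S" "\<And>x. x \<notin> S \<Longrightarrow> (F m has_real_derivative F (Suc m) x) (at x)"
    using F unfolding jet_def by blast
  have "(deriv ^^ (m + 1)) (F 0) x = F (Suc m) x" if "x \<notin> S" for x
    using S(2)[OF that] jet_funpow_deriv[OF F order_refl] by (auto intro: DERIV_imp_deriv)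
  then show ?thesis
    unfolding seminorm_def
    using S(1) by (intro l2norm_eq_nrm[of _ "S \<inter> {- pi..pi}"])
      (auto simp: locally_finite_def intro: jet_loc_bdd_meas[OF F])
qed

lemma l2norm_jet: "jet m F \<Longrightarrow> l2norm (F 0) = nrm (- pi) pi (F 0)"
  by (rule l2norm_eq_nrm[of _ "{}"]) (auto intro: jet_loc_bdd_meas)

text \<open>Intended for a node, where the polynomials of the two adjacent cells share their value
  and the next derivative: both one-sided difference quotients have the same limit.\<close>

lemma DERIV_glue:
  assumes "a < x" "x < (b :: real)"
    and p: "(p has_real_derivative D) (at x)" "\<And>y. a < y \<Longrightarrow> y \<le> x \<Longrightarrow> f y = p y"
    and q: "(q has_real_derivative D) (at x)" "\<And>y. x \<le> y \<Longrightarrow> y < b \<Longrightarrow> f y = q y"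
  shows "(f has_real_derivative D) (at x)"
  unfolding has_field_derivative_iff
proof (rule filterlim_split_at)
  have "eventually (\<lambda>y. f y = p y) (at_left x)"
    using assms(1) p(2) unfolding eventually_at_left_field by (metis less_imp_le)
  then have "(f has_real_derivative D) (at_left x)"
    using has_field_derivative_cong_eventually[of f p x "{..<x}" D] p(2)[of x] assms(1)
      has_field_derivative_at_within[OF p(1)] by simp
  then show "((\<lambda>y. (f y - f x) / (y - x)) \<longlongrightarrow> D) (at_left x)"
    unfolding has_field_derivative_iff .
  have "eventually (\<lambda>y. f y = q y) (at_right x)"
    using assms(2) q(2) unfolding eventually_at_right_field by (metis less_imp_le)
  then have "(f has_real_derivative D) (at_right x)"
    using has_field_derivative_cong_eventually[of f q x "{x<..}" D] q(2)[of x] assms(2)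
      has_field_derivative_at_within[OF q(1)] by simp
  then show "((\<lambda>y. (f y - f x) / (y - x)) \<longlongrightarrow> D) (at_right x)"
    unfolding has_field_derivative_iff .
qed

lemma isCont_glue:
  assumes "a < x" "x < (b :: real)"
    and p: "isCont p x" "\<And>y. a < y \<Longrightarrow> y \<le> x \<Longrightarrow> f y = (p y :: real)"
    and q: "isCont q x" "\<And>y. x \<le> y \<Longrightarrow> y < b \<Longrightarrow> f y = q y"
  shows "isCont f x"
  unfolding isCont_def
proof (rule filterlim_split_at)
  have "(p \<longlongrightarrow> f x) (at_left x)"
    using p assms(1) by (auto simp: isCont_def intro: tendsto_within_subset[of _ _ _ UNIV])
  moreover have "eventually (\<lambda>y. p y = f y) (at_left x)"
    using assms(1) p(2) unfolding eventually_at_left_field by (metis less_imp_le)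
  ultimately show "(f \<longlongrightarrow> f x) (at_left x)" by (rule Lim_transform_eventually)
  have "(q \<longlongrightarrow> f x) (at_right x)"
    using q assms(2) by (auto simp: isCont_def intro: tendsto_within_subset[of _ _ _ UNIV])
  moreover have "eventually (\<lambda>y. q y = f y) (at_right x)"
    using assms(2) q(2) unfolding eventually_at_right_field by (metis less_imp_le)
  ultimately show "(f \<longlongrightarrow> f x) (at_right x)" by (rule Lim_transform_eventually)
qed

section \<open>Periodic piecewise interpolants and their derivatives\<close>

lemma pderiv_funpow_pcompose:
  "(pderiv ^^ j) (pcompose q [:c, 1:]) = pcompose ((pderiv ^^ j) q) [:c, 1 :: real:]"
  by (induction j) (simp_all add: pderiv_pcompose pderiv_pCons)

text \<open>Both sides have the same Hermite data, because all derivatives of \<open>f\<close> are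
  periodic, so uniqueness applies. This is the source of the periodicity of the interpolant.\<close>

lemma hermite_poly_shift:
  assumes "a \<noteq> b" "periodic_2pi f"
  shows "hermite_poly m a b f = pcompose (hermite_poly m (a + 2 * pi) (b + 2 * pi) f) [:2 * pi, 1:]"
proof -
  let ?q = "hermite_poly m a b f"
    and ?r = "pcompose (hermite_poly m (a + 2 * pi) (b + 2 * pi) f) [:2 * pi, 1:]"
  have per: "(deriv ^^ j) f (x + 2 * pi) = (deriv ^^ j) f x" for j x
    using periodic_2pi_funpow_deriv[OF assms(2)] by (simp add: periodic_2pi_def)
  have ab: "a + 2 * pi \<noteq> b + 2 * pi" using assms(1) by simp
  have "?q - ?r = 0"
  proof (rule hermite_data_zero_unique[OF assms(1), of _ m])
    show "degree (?q - ?r) \<le> 2 * m + 1"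
      using degree_hermite_poly[OF assms(1)] degree_hermite_poly[OF ab]
      by (intro degree_diff_le) (auto simp: degree_pcompose)
    show "poly ((pderiv ^^ j) (?q - ?r)) a = 0" if "j \<le> m" for j
      using hermite_poly_left[OF assms(1) that, of f] hermite_poly_left[OF ab that, of f]
      by (simp add: pderiv_funpow_diff pderiv_funpow_pcompose poly_pcompose per add.commute)
    show "poly ((pderiv ^^ j) (?q - ?r)) b = 0" if "j \<le> m" for j
      using hermite_poly_right[OF assms(1) that, of f] hermite_poly_right[OF ab that, of f]
      by (simp add: pderiv_funpow_diff pderiv_funpow_pcompose poly_pcompose per add.commute)
  qed
  then show ?thesis by simp
qed

text \<open>Differentiation is carried out cell by cell on the polynomials. For orders above
  \<open>m\<close> adjacent cells may disagree at a node; the floor then selects the cell to the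
  right.\<close>

definition hermite_jet :: "nat \<Rightarrow> real \<Rightarrow> nat \<Rightarrow> (real \<Rightarrow> real) \<Rightarrow> nat \<Rightarrow> real \<Rightarrow> real" where
  "hermite_jet m h k f j x =
     (let i = \<lfloor>(x + pi) / h - grid_offset k\<rfloor>
      in poly ((pderiv ^^ j) (hermite_poly m (node h k i) (node h k (i + 1)) f)) x)"

lemma hermite_jet_0: "hermite_jet m h k f 0 = hermite_interp m h k f"
  by (rule ext) (simp add: hermite_jet_def hermite_interp_def)

definition piecewise_poly_jet :: "nat \<Rightarrow> real \<Rightarrow> nat \<Rightarrow> (nat \<Rightarrow> real \<Rightarrow> real) \<Rightarrow> bool" where
  "piecewise_poly_jet d h k P \<longleftrightarrow> (\<forall>i. \<exists>q. degree q \<le> d \<and>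
     (\<forall>j x. node h k i \<le> x \<longrightarrow> x < node h k (i + 1) \<longrightarrow> P j x = poly ((pderiv ^^ j) q) x))"

lemma piecewise_poly_jet_diff:
  assumes "piecewise_poly_jet d h k P" "piecewise_poly_jet d h k Q"
  shows "piecewise_poly_jet d h k (\<lambda>j x. P j x - Q j x)"
  unfolding piecewise_poly_jet_def
proof
  fix i
  obtain p q where "degree p \<le> d" "degree q \<le> d"
    "\<And>j x. node h k i \<le> x \<Longrightarrow> x < node h k (i + 1) \<Longrightarrow> P j x = poly ((pderiv ^^ j) p) x"
    "\<And>j x. node h k i \<le> x \<Longrightarrow> x < node h k (i + 1) \<Longrightarrow> Q j x = poly ((pderiv ^^ j) q) x"
    using assms unfolding piecewise_poly_jet_def by metis
  then show "\<exists>q. degree q \<le> d \<and>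
     (\<forall>j x. node h k i \<le> x \<longrightarrow> x < node h k (i + 1) \<longrightarrow> P j x - Q j x = poly ((pderiv ^^ j) q) x)"
    by (intro exI[of _ "p - q"]) (auto simp: pderiv_funpow_diff intro: degree_diff_le)
qed

section \<open>Uniform meshes on the periodic interval\<close>

locale mesh =
  fixes nx :: nat and h :: real
  assumes nx: "nx \<ge> 1" and h: "h = 2 * pi / real nx"
begin

lemma h_pos: "h > 0"
  using nx h by simp

lemma nx_h: "real nx * h = 2 * pi"
proof -
  have "real nx \<noteq> 0" using nx by simp
  then show ?thesis by (subst h) simp
qed

lemma node_Suc: "node h k (i + 1) = node h k i + h"
  by (simp add: node_def algebra_simps)

lemma node_less: "node h k i < node h k (i + 1)"
  using h_pos by (simp add: node_Suc)

lemma node_period: "node h k (i + int nx) = node h k i + 2 * pi"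
  using nx_h by (simp add: node_def distrib_right)

lemma cell_eq_iff:
  "\<lfloor>(x + pi) / h - grid_offset k\<rfloor> = i \<longleftrightarrow> node h k i \<le> x \<and> x < node h k (i + 1)"
proof -
  have "\<lfloor>(x + pi) / h - grid_offset k\<rfloor> = i \<longleftrightarrow>
      of_int i + grid_offset k \<le> (x + pi) / h \<and> (x + pi) / h < of_int i + grid_offset k + 1"
    unfolding floor_eq_iff by (auto simp: algebra_simps)
  also have "\<dots> \<longleftrightarrow> (of_int i + grid_offset k) * h \<le> x + pi \<and> x + pi < (of_int i + grid_offset k + 1) * h"
    using h_pos by (simp add: pos_le_divide_eq pos_divide_less_eq)
  also have "\<dots> \<longleftrightarrow> node h k i \<le> x \<and> x < node h k (i + 1)"
    by (auto simp: node_def algebra_simps)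
  finally show ?thesis .
qed

lemma cell_exists: "\<exists>i. node h k i \<le> x \<and> x < node h k (i + 1)"
  using cell_eq_iff by blast

lemma hermite_jet_cell:
  assumes "node h k i \<le> x" "x < node h k (i + 1)"
  shows "hermite_jet m h k f j x = poly ((pderiv ^^ j) (hermite_poly m (node h k i) (node h k (i + 1)) f)) x"
  using cell_eq_iff[of x k i] assms by (simp add: hermite_jet_def)

text \<open>At the right endpoint the floor already selects the next cell, but up to order
  \<open>m\<close> the polynomials of both cells carry the same nodal data.\<close>

lemma hermite_jet_cell_closed:
  assumes "node h k i \<le> x" "x \<le> node h k (i + 1)" "j \<le> m"
  shows "hermite_jet m h k f j x = poly ((pderiv ^^ j) (hermite_poly m (node h k i) (node h k (i + 1)) f)) x"
proof (cases "x = node h k (i + 1)")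
  case True
  have "hermite_jet m h k f j x = (deriv ^^ j) f x"
    using hermite_jet_cell[of k "i + 1" x m f j] node_less[of k "i + 1"] True
      hermite_poly_left[OF less_imp_neq[OF node_less[of k "i + 1"]] assms(3), of f] by simp
  then show ?thesis
    using True hermite_poly_right[OF less_imp_neq[OF node_less] assms(3)] by simp
qed (use assms hermite_jet_cell in auto)

lemma hermite_jet_node:
  "j \<le> m \<Longrightarrow> hermite_jet m h k f j (node h k i) = (deriv ^^ j) f (node h k i)"
  using hermite_jet_cell[of k i "node h k i" m f j] node_less[of k i]
    hermite_poly_left[OF less_imp_neq[OF node_less]] by simp

lemma piecewise_poly_jet_hermite: "piecewise_poly_jet (2 * m + 1) h k (hermite_jet m h k f)"
  unfolding piecewise_poly_jet_def
  using hermite_jet_cell degree_hermite_poly[OF less_imp_neq[OF node_less]] by blast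

lemma cell_mono:
  assumes "x \<le> y"
  shows "\<lfloor>(x + pi) / h - grid_offset k\<rfloor> \<le> \<lfloor>(y + pi) / h - grid_offset k\<rfloor>"
  using assms h_pos by (intro floor_mono) (simp add: divide_right_mono)

lemma locally_finite_nodes: "locally_finite (range (node h k))"
proof -
  have "finite (range (node h k) \<inter> {a..b})" for a b
  proof (rule finite_subset)
    let ?c = "\<lambda>x. \<lfloor>(x + pi) / h - grid_offset k\<rfloor>"
    have "i \<in> {?c a..?c b}" if "node h k i \<in> {a..b}" for i
    proof -
      have "?c (node h k i) = i"
        using cell_eq_iff[of "node h k i" k i] node_less[of k i] by simp
      then show ?thesis
        using cell_mono[of a "node h k i" k] cell_mono[of "node h k i" b k] that by simp
    qed
    then show "range (node h k) \<inter> {a..b} \<subseteq> node h k ` {?c a..?c b}" by blast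
  qed simp
  then show ?thesis by (simp add: locally_finite_def)
qed

lemma hermite_jet_DERIV_cell:
  assumes "node h k i < x" "x < node h k (i + 1)"
  shows "(hermite_jet m h k f j has_real_derivative hermite_jet m h k f (Suc j) x) (at x)"
proof (rule has_field_derivative_transform_within_open[where S = "{node h k i<..<node h k (i + 1)}"])
  show "(poly ((pderiv ^^ j) (hermite_poly m (node h k i) (node h k (i + 1)) f))
      has_real_derivative hermite_jet m h k f (Suc j) x) (at x)"
    using poly_DERIV[of "(pderiv ^^ j) (hermite_poly m (node h k i) (node h k (i + 1)) f)" x]
    by (simp add: hermite_jet_cell[of k i] assms less_imp_le)
qed (use assms in \<open>auto simp: hermite_jet_cell[of k i]\<close>)

lemma loc_bdd_meas_hermite_jet: "loc_bdd_meas (hermite_jet m h k f j)"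
proof -
  let ?c = "\<lambda>x. \<lfloor>(x + pi) / h - grid_offset k\<rfloor>"
  let ?p = "\<lambda>i. poly ((pderiv ^^ j) (hermite_poly m (node h k i) (node h k (i + 1)) f))"
  have eq: "hermite_jet m h k f j = (\<lambda>x. ?p (?c x) x)"
    by (rule ext) (simp add: hermite_jet_def Let_def)
  have c: "continuous_on A (poly q)" for A and q :: "real poly"
    by (intro continuous_intros)
  \<comment> \<open>By \<open>cell_mono\<close> only finitely many cells meet a bounded interval,
    and each contributes a continuous polynomial.\<close>
  have "bounded ((\<lambda>x. ?p (?c x) x) ` {a..b})" for a b
  proof (rule bounded_subset)
    show "bounded (\<Union>i\<in>{?c a..?c b}. ?p i ` {a..b})"
      by (intro bounded_UN ballI compact_imp_bounded compact_continuous_image c) auto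
    show "(\<lambda>x. ?p (?c x) x) ` {a..b} \<subseteq> (\<Union>i\<in>{?c a..?c b}. ?p i ` {a..b})"
    proof (rule image_subsetI)
      fix x assume x: "x \<in> {a..b}"
      then have "?c x \<in> {?c a..?c b}"
        using cell_mono[of a x k] cell_mono[of x b k] by simp
      then show "?p (?c x) x \<in> (\<Union>i\<in>{?c a..?c b}. ?p i ` {a..b})"
        using x by (intro UN_I[of "?c x"] imageI)
    qed
  qed
  moreover have "(\<lambda>x. ?p (?c x) x) \<in> borel_measurable borel"
    by (rule measurable_compose_countable[where f = ?p])
      (auto intro: borel_measurable_continuous_onI c)
  ultimately show ?thesis unfolding eq loc_bdd_meas_def by blast
qed

lemma periodic_hermite_jet:
  assumes "periodic_2pi f"
  shows "periodic_2pi (hermite_jet m h k f j)"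
  unfolding periodic_2pi_def
proof
  fix x
  obtain i where i: "node h k i \<le> x" "x < node h k (i + 1)" using cell_exists by blast
  have n: "node h k (i + int nx) = node h k i + 2 * pi"
    "node h k (i + int nx + 1) = node h k (i + 1) + 2 * pi"
    using node_period[of k i] node_period[of k "i + 1"] by (simp_all add: algebra_simps)
  have "hermite_jet m h k f j (x + 2 * pi) = poly ((pderiv ^^ j)
      (hermite_poly m (node h k i + 2 * pi) (node h k (i + 1) + 2 * pi) f)) (x + 2 * pi)"
    using i n hermite_jet_cell[of k "i + int nx" "x + 2 * pi" m f j] by simp
  also have "\<dots> = hermite_jet m h k f j x"
    unfolding hermite_jet_cell[OF i]
      hermite_poly_shift[OF less_imp_neq[OF node_less[of k i]] assms]
    by (simp add: pderiv_funpow_pcompose poly_pcompose add.commute)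
  finally show "hermite_jet m h k f j (x + 2 * pi) = hermite_jet m h k f j x" .
qed

text \<open>Inside a cell everything is polynomial. At a node, the shared data of orders up to
  \<open>m\<close> allow gluing of the derivatives below order \<open>m\<close> and continuity at
  order \<open>m\<close>; the derivative of order m + 1 is claimed off the nodes, a locally finite
  set.\<close>

lemma jet_hermite_jet:
  assumes "periodic_2pi f"
  shows "jet m (hermite_jet m h k f)"
proof -
  let ?H = "hermite_jet m h k f"
  let ?q = "\<lambda>i. hermite_poly m (node h k i) (node h k (i + 1)) f"
  have left: "node h k (i - 1) < node h k i" for i
    using node_less[of k "i - 1"] by simp
  have eqs: "\<And>y. node h k (i - 1) < y \<Longrightarrow> y \<le> node h k i \<Longrightarrow> ?H j y = poly ((pderiv ^^ j) (?q (i - 1))) y"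
    "\<And>y. node h k i \<le> y \<Longrightarrow> y < node h k (i + 1) \<Longrightarrow> ?H j y = poly ((pderiv ^^ j) (?q i)) y"
    if "j \<le> m" for i j
    using hermite_jet_cell_closed[of k "i - 1" _ j m f] hermite_jet_cell[of k i _ m f j] that by auto
  have "(?H j has_real_derivative ?H (Suc j) x) (at x)" if j: "j < m" for j x
  proof -
    obtain i where i: "node h k i \<le> x" "x < node h k (i + 1)" using cell_exists by blast
    show ?thesis
    proof (cases "x = node h k i")
      case True
      show ?thesis
      proof (rule DERIV_glue[OF left[of i, folded True] i(2)])
        show "(poly ((pderiv ^^ j) (?q (i - 1))) has_real_derivative ?H (Suc j) x) (at x)"
          using eqs(1)[of "Suc j" i x] j True left[of i] poly_DERIV[of "(pderiv ^^ j) (?q (i - 1))" x]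
          by simp
        show "(poly ((pderiv ^^ j) (?q i)) has_real_derivative ?H (Suc j) x) (at x)"
          using eqs(2)[of "Suc j" i x] j i poly_DERIV[of "(pderiv ^^ j) (?q i)" x]
          by simp
      qed (use eqs[of j i] j True in auto)
    qed (use i hermite_jet_DERIV_cell[of k i x] in auto)
  qed
  moreover have "isCont (?H m) x" for x
  proof -
    obtain i where i: "node h k i \<le> x" "x < node h k (i + 1)" using cell_exists by blast
    show ?thesis
    proof (cases "x = node h k i")
      case True
      show ?thesis
        by (rule isCont_glue[OF left[of i, folded True] i(2),
              of "poly ((pderiv ^^ m) (?q (i - 1)))" _ "poly ((pderiv ^^ m) (?q i))"])
           (use eqs[of m i] True in \<open>auto intro!: continuous_intros\<close>)
    qed (use i hermite_jet_DERIV_cell[of k i x m f m] in \<open>auto intro: DERIV_isCont\<close>)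
  qed
  moreover have "(?H m has_real_derivative ?H (Suc m) x) (at x)" if "x \<notin> range (node h k)" for x
  proof -
    obtain i where i: "node h k i \<le> x" "x < node h k (i + 1)" using cell_exists by blast
    then have "node h k i < x" using that by (metis order_le_less rangeI)
    then show ?thesis using i hermite_jet_DERIV_cell by blast
  qed
  ultimately show ?thesis
    unfolding jet_def
    using locally_finite_nodes[of k] loc_bdd_meas_hermite_jet periodic_hermite_jet[OF assms]
    by (auto intro!: continuous_at_imp_continuous_on)
qed

end

section \<open>Orthogonality of the interpolation error\<close>

lemma poly_funpow_DERIV:
  "(poly ((pderiv ^^ j) q) has_real_derivative poly ((pderiv ^^ Suc j) q) x) (at x)"
  by (simp add: poly_DERIV)

context mesh
begin

lemma ip_cells:
  assumes "loc_bdd_meas f" "loc_bdd_meas g"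
  shows "ip (node h k 0) (node h k (int n)) f g = (\<Sum>i<n. ip (node h k (int i)) (node h k (int i + 1)) f g)"
proof (induction n)
  case 0
  then show ?case by (simp add: ip_def)
next
  case (Suc n)
  have "ip (node h k 0) (node h k (int n + 1)) f g =
      ip (node h k 0) (node h k (int n)) f g + ip (node h k (int n)) (node h k (int n + 1)) f g"
    by (rule ip_combine) (use assms h_pos node_less[of k "int n"] in \<open>auto simp: node_def\<close>)
  then show ?case using Suc by (simp add: add.commute)
qed

lemma ip_eq_sum_cells:
  assumes "loc_bdd_meas f" "periodic_2pi f" "loc_bdd_meas g" "periodic_2pi g"
  shows "ip (- pi) pi f g = (\<Sum>i<nx. ip (node h k (int i)) (node h k (int i + 1)) f g)"
  using ip_cells[OF assms(1,3), of k nx] ip_periodic[OF assms, of "node h k 0"] node_period[of k 0]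
  by simp

section \<open>Functions with vanishing nodal data: Poincare inequality and integration by
  parts\<close>

definition vanishes_at_nodes :: "nat \<Rightarrow> nat \<Rightarrow> (nat \<Rightarrow> real \<Rightarrow> real) \<Rightarrow> bool" where
  "vanishes_at_nodes m k W \<longleftrightarrow> (\<forall>j\<le>m. \<forall>i. W j (node h k i) = 0)"

lemma jet_DERIV_off_finite:
  assumes "jet m W" "j \<le> m"
  obtains S where "finite S" "\<And>x. x \<in> {a<..<b} - S \<Longrightarrow> (W j has_real_derivative W (Suc j) x) (at x)"
proof (cases "j = m")
  case True
  obtain S where "locally_finite S" "\<And>x. x \<notin> S \<Longrightarrow> (W m has_real_derivative W (Suc m) x) (at x)"
    using assms(1) unfolding jet_def by blast
  then show ?thesis
    using True by (intro that[of "S \<inter> {a..b}"]) (auto simp: locally_finite_def)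
next
  case False
  then show ?thesis
    using assms by (intro that[of "{}"]) (auto simp: jet_def)
qed

lemma nrm_poincare_step:
  assumes W: "jet m W" "vanishes_at_nodes m k W" and j: "j \<le> m"
  shows "nrm (- pi) pi (W j) \<le> h * nrm (- pi) pi (W (Suc j))"
proof -
  note lbm = jet_loc_bdd_meas[OF W(1), of j] jet_loc_bdd_meas[OF W(1), of "Suc j"]
  note per = jet_periodic[OF W(1), of j] jet_periodic[OF W(1), of "Suc j"]
  have cell: "ip (node h k i) (node h k (i + 1)) (W j) (W j) \<le>
      h\<^sup>2 * ip (node h k i) (node h k (i + 1)) (W (Suc j)) (W (Suc j))" for i
  proof -
    obtain S where S: "finite S"
      "\<And>x. x \<in> {node h k i<..<node h k (i + 1)} - S \<Longrightarrow> (W j has_real_derivative W (Suc j) x) (at x)"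
      using jet_DERIV_off_finite[OF W(1) j] by metis
    have "ip (node h k i) (node h k (i + 1)) (W j) (W j) \<le> (node h k (i + 1) - node h k i)\<^sup>2
        * ip (node h k i) (node h k (i + 1)) (W (Suc j)) (W (Suc j))"
    proof (rule poincare_cell[OF less_imp_le[OF node_less] S(1) continuous_on_subset[OF jet_cont[OF W(1) j]] _ S(2)])
      show "W j (node h k i) = 0"
        using W(2) j by (simp add: vanishes_at_nodes_def)
    qed (use lbm j in auto)
    then show ?thesis using node_Suc[of k i] by simp
  qed
  have "ip (- pi) pi (W j) (W j) \<le> h\<^sup>2 * ip (- pi) pi (W (Suc j)) (W (Suc j))"
    using ip_eq_sum_cells[of "W j" "W j" k] ip_eq_sum_cells[of "W (Suc j)" "W (Suc j)" k] lbm per j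
    by (simp add: sum_distrib_left sum_mono cell)
  then have "nrm (- pi) pi (W j) \<le> sqrt (h\<^sup>2 * ip (- pi) pi (W (Suc j)) (W (Suc j)))"
    by (simp add: nrm_def)
  then show ?thesis using h_pos by (simp add: nrm_def real_sqrt_mult)
qed

text \<open>All orders up to \<open>m\<close> vanish at the nodes, so the one-step inequality can be
  applied m + 1 times, each time gaining a factor \<open>h\<close>.\<close>

lemma nrm_poincare:
  assumes W: "jet m W" "vanishes_at_nodes m k W"
  shows "nrm (- pi) pi (W 0) \<le> h ^ Suc m * nrm (- pi) pi (W (Suc m))"
proof -
  have "nrm (- pi) pi (W 0) \<le> h ^ n * nrm (- pi) pi (W n)" if "n \<le> Suc m" for n
    using that
  proof (induction n)
    case (Suc n)
    have "h ^ n * nrm (- pi) pi (W n) \<le> h ^ n * (h * nrm (- pi) pi (W (Suc n)))"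
      using Suc.prems h_pos by (intro mult_left_mono nrm_poincare_step[OF W]) auto
    then show ?case using Suc by (simp add: mult_ac)
  qed simp
  from this[OF order_refl] show ?thesis .
qed

text \<open>Derivatives are moved from \<open>W\<close> to \<open>V\<close> one at a time. Every
  derivative of \<open>W\<close> that appears in a boundary term has order at most \<open>m\<close>
  and vanishes at both ends.\<close>

lemma ip_by_parts_cell:
  assumes W: "jet m W" "vanishes_at_nodes m k W"
    and V: "\<And>j x. j < n \<Longrightarrow> (V j has_real_derivative V (Suc j) x) (at x)" "continuous_on UNIV (V n)"
    and n: "n \<le> Suc m"
  shows "ip (node h k i) (node h k (i + 1)) (W (Suc m)) (V 0) =
    (- 1) ^ n * ip (node h k i) (node h k (i + 1)) (W (Suc m - n)) (V n)"
  using V n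
proof (induction n)
  case (Suc n)
  have "continuous_on UNIV (V n)"
    using Suc.prems(1) by (auto intro!: continuous_at_imp_continuous_on DERIV_isCont)
  then have IH: "ip (node h k i) (node h k (i + 1)) (W (Suc m)) (V 0) =
    (- 1) ^ n * ip (node h k i) (node h k (i + 1)) (W (Suc m - n)) (V n)"
    using Suc by simp
  define j where "j = m - n"
  have j: "Suc m - n = Suc j" "Suc m - Suc n = j" "j \<le> m"
    using Suc.prems(3) by (auto simp: j_def)
  obtain S where S: "finite S"
    "\<And>x. x \<in> {node h k i<..<node h k (i + 1)} - S \<Longrightarrow> (W j has_real_derivative W (Suc j) x) (at x)"
    using jet_DERIV_off_finite[OF W(1) j(3)] by metis
  have "ip (node h k i) (node h k (i + 1)) (W (Suc j)) (V n) =
      - ip (node h k i) (node h k (i + 1)) (W j) (V (Suc n))"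
  proof (rule ip_by_parts[OF less_imp_le[OF node_less] S(1) continuous_on_subset[OF jet_cont[OF W(1) j(3)]] _ _ S(2)])
    show "W j (node h k i) = 0" "W j (node h k (i + 1)) = 0"
      using W(2) j(3) by (simp_all add: vanishes_at_nodes_def)
  qed (use Suc.prems(1,2) j(3) jet_loc_bdd_meas[OF W(1)] loc_bdd_meas_cont in auto)
  then show ?case using IH j by simp
qed simp

text \<open>The test function may jump across nodes: in each half-open cell it only has to agree
  with some smooth family \<open>\<Phi>\<close>. Since \<open>W\<close> vanishes at every node, no
  jump terms arise when the cells are summed.\<close>

lemma ip_by_parts_mesh:
  assumes W: "jet m W" "vanishes_at_nodes m k W"
    and V: "loc_bdd_meas (V 0)" "periodic_2pi (V 0)" "loc_bdd_meas (V (Suc m))" "periodic_2pi (V (Suc m))"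
    and loc: "\<And>i. \<exists>\<Phi>. (\<forall>j\<le>m. \<forall>x. (\<Phi> j has_real_derivative \<Phi> (Suc j) x) (at x)) \<and>
      continuous_on UNIV (\<Phi> (Suc m)) \<and>
      (\<forall>x. node h k i \<le> x \<longrightarrow> x < node h k (i + 1) \<longrightarrow> V 0 x = \<Phi> 0 x \<and> V (Suc m) x = \<Phi> (Suc m) x)"
  shows "ip (- pi) pi (W (Suc m)) (V 0) = (- 1) ^ Suc m * ip (- pi) pi (W 0) (V (Suc m))"
proof -
  have cell: "ip (node h k i) (node h k (i + 1)) (W (Suc m)) (V 0) =
    (- 1) ^ Suc m * ip (node h k i) (node h k (i + 1)) (W 0) (V (Suc m))" for i
  proof -
    obtain \<Phi> where \<Phi>: "\<And>j x. j \<le> m \<Longrightarrow> (\<Phi> j has_real_derivative \<Phi> (Suc j) x) (at x)"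
      "continuous_on UNIV (\<Phi> (Suc m))"
      "\<And>x. node h k i \<le> x \<Longrightarrow> x < node h k (i + 1) \<Longrightarrow> V 0 x = \<Phi> 0 x \<and> V (Suc m) x = \<Phi> (Suc m) x"
      using loc[of i] by blast
    have *: "ip (node h k i) (node h k (i + 1)) f (V l) = ip (node h k i) (node h k (i + 1)) f (\<Phi> l)"
      if "l = 0 \<or> l = Suc m" for f l
      using \<Phi>(3) that by (intro ip_cong_finite[of "{node h k (i + 1)}"]) auto
    show ?thesis
      using ip_by_parts_cell[OF W, of "Suc m" \<Phi> i] \<Phi>(1,2) by (simp add: *)
  qed
  show ?thesis
    using ip_eq_sum_cells[of "W (Suc m)" "V 0" k] ip_eq_sum_cells[of "W 0" "V (Suc m)" k]
      jet_loc_bdd_meas[OF W(1)] jet_periodic[OF W(1)] V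
    by (simp only: cell sum_distrib_left)
qed

text \<open>After m + 1 integrations by parts the test function has become the derivative of order
  2m + 2 of a polynomial of degree at most 2m + 1, which is zero. This is the orthogonality on which
  the energy argument rests.\<close>

lemma ip_piecewise_poly_eq_0:
  assumes W: "jet m W" "vanishes_at_nodes m k W"
    and P: "piecewise_poly_jet (2 * m + 1) h k P" "jet m P"
  shows "ip (- pi) pi (W (Suc m)) (P (Suc m)) = 0"
proof -
  \<comment> \<open>Index 0 holds the derivative of order m + 1 of \<open>P\<close>, and index m + 1
    its vanishing derivative of order 2m + 2; the values in between are placeholders.\<close>
  let ?V = "\<lambda>j::nat. if j = 0 then P (Suc m) else (\<lambda>x. 0)"
  have "ip (- pi) pi (W (Suc m)) (?V 0) = (- 1) ^ Suc m * ip (- pi) pi (W 0) (?V (Suc m))"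
  proof (rule ip_by_parts_mesh[OF W, where V = ?V])
    fix i
    obtain q where q: "degree q \<le> 2 * m + 1"
      "\<And>j x. node h k i \<le> x \<Longrightarrow> x < node h k (i + 1) \<Longrightarrow> P j x = poly ((pderiv ^^ j) q) x"
      using P(1) unfolding piecewise_poly_jet_def by blast
    let ?F = "\<lambda>j. poly ((pderiv ^^ (Suc m + j)) q)"
    have "(pderiv ^^ (Suc m + Suc m)) q = 0"
      using q(1) by (intro pderiv_funpow_eq_0) simp
    then show "\<exists>\<Phi>. (\<forall>j\<le>m. \<forall>x. (\<Phi> j has_real_derivative \<Phi> (Suc j) x) (at x)) \<and>
      continuous_on UNIV (\<Phi> (Suc m)) \<and>
      (\<forall>x. node h k i \<le> x \<longrightarrow> x < node h k (i + 1) \<longrightarrow> ?V 0 x = \<Phi> 0 x \<and> ?V (Suc m) x = \<Phi> (Suc m) x)"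
      using q(2)[of _ "Suc m"]
      by (intro exI[of _ ?F])
        (auto intro!: continuous_intros poly_funpow_DERIV simp del: funpow.simps)
  qed (use jet_loc_bdd_meas[OF P(2)] jet_periodic[OF P(2)] loc_bdd_meas_const in \<open>auto simp: periodic_2pi_def\<close>)
  then show ?thesis by (simp add: ip_def)
qed

section \<open>The interpolation error and its size for smooth functions\<close>

lemma vanishes_interp_error:
  assumes "jet m F"
  shows "vanishes_at_nodes m k (\<lambda>j x. F j x - hermite_jet m h k (F 0) j x)"
  using hermite_jet_node jet_funpow_deriv[OF assms] by (simp add: vanishes_at_nodes_def)

lemma jet_interp_error:
  assumes "jet m F"
  shows "jet m (\<lambda>j x. F j x - hermite_jet m h k (F 0) j x)"
  using jet_periodic[OF assms, of 0] by (intro jet_diff assms jet_hermite_jet) auto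

text \<open>A duality argument. By orthogonality the squared norm is the inner product of the error
  with \<open>V\<close> at order m + 1; integration by parts moves all derivatives of the error onto
  \<open>V\<close>, and the Poincare inequality returns the norm being estimated times
  \<open>h ^ Suc m\<close>. One factor of that norm then cancels.\<close>

lemma nrm_interp_error:
  assumes V: "\<And>j x. j \<le> 2 * m + 1 \<Longrightarrow> (V j has_real_derivative V (Suc j) x) (at x)"
    "continuous_on UNIV (V (2 * m + 2))" "\<And>j. j \<le> 2 * m + 2 \<Longrightarrow> periodic_2pi (V j)"
  shows "nrm (- pi) pi (\<lambda>x. V (Suc m) x - hermite_jet m h k (V 0) (Suc m) x)
    \<le> h ^ Suc m * nrm (- pi) pi (V (2 * m + 2))"
proof -
  have c: "continuous_on UNIV (V j)" if "j \<le> 2 * m + 2" for j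
  proof (cases "j = 2 * m + 2")
    case False
    then show ?thesis
      using V(1)[of j] that by (auto intro!: continuous_at_imp_continuous_on DERIV_isCont)
  qed (use V(2) in simp)
  have V_jet: "jet m V"
    unfolding jet_def using V c
    by (auto intro!: loc_bdd_meas_cont exI[of _ "{}"] simp: locally_finite_def)
  let ?W = "\<lambda>j x. V j x - hermite_jet m h k (V 0) j x"
  let ?n = "nrm (- pi) pi (?W (Suc m))"
  note W = jet_interp_error[OF V_jet, of k] vanishes_interp_error[OF V_jet, of k]
  note Wm = jet_loc_bdd_meas[OF W(1) order_refl]
  have H: "jet m (hermite_jet m h k (V 0))"
    using V(3)[of 0] by (intro jet_hermite_jet) simp
  have "?n\<^sup>2 = ip (- pi) pi (?W (Suc m)) (V (Suc m))
      - ip (- pi) pi (?W (Suc m)) (hermite_jet m h k (V 0) (Suc m))"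
    unfolding nrm_sq[OF Wm]
    using jet_loc_bdd_meas[OF V_jet order_refl] jet_loc_bdd_meas[OF H order_refl] Wm
    by (intro ip_diff_right)
  also have "\<dots> = ip (- pi) pi (?W (Suc m)) (V (Suc m))"
    using ip_piecewise_poly_eq_0[OF W piecewise_poly_jet_hermite H] by simp
  also have "\<dots> = (- 1) ^ Suc m * ip (- pi) pi (?W 0) (V (2 * m + 2))"
  proof -
    have "\<exists>\<Phi>. (\<forall>j\<le>m. \<forall>x. (\<Phi> j has_real_derivative \<Phi> (Suc j) x) (at x)) \<and>
      continuous_on UNIV (\<Phi> (Suc m)) \<and>
      (\<forall>x. node h k i \<le> x \<longrightarrow> x < node h k (i + 1) \<longrightarrow>
        V (Suc m + 0) x = \<Phi> 0 x \<and> V (Suc m + Suc m) x = \<Phi> (Suc m) x)" for i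
      using V(1)[of "Suc m + _"] V(2) by (intro exI[of _ "\<lambda>j. V (Suc m + j)"]) (auto simp: mult_2)
    from ip_by_parts_mesh[OF W, of "\<lambda>j. V (Suc m + j)", OF _ _ _ _ this]
    show ?thesis
      using c V(3) loc_bdd_meas_cont by (simp add: mult_2)
  qed
  also have "\<dots> \<le> \<bar>ip (- pi) pi (?W 0) (V (2 * m + 2))\<bar>"
    by (cases "even m") auto
  also have "\<dots> \<le> nrm (- pi) pi (?W 0) * nrm (- pi) pi (V (2 * m + 2))"
    by (intro abs_ip_le_nrm jet_loc_bdd_meas[OF W(1)] loc_bdd_meas_cont V(2)) simp
  also have "\<dots> \<le> (h ^ Suc m * ?n) * nrm (- pi) pi (V (2 * m + 2))"
    by (intro mult_right_mono nrm_poincare[OF W] nrm_nonneg loc_bdd_meas_cont V(2))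
  finally have le: "?n * ?n \<le> ?n * (h ^ Suc m * nrm (- pi) pi (V (2 * m + 2)))"
    by (simp add: power2_eq_square mult_ac)
  show ?thesis
  proof (cases "?n = 0")
    case True
    then show ?thesis using h_pos nrm_nonneg[OF loc_bdd_meas_cont[OF V(2)]] by simp
  next
    case False
    then have "?n > 0" using nrm_nonneg[OF Wm, of "- pi" pi] by linarith
    then show ?thesis using le by simp
  qed
qed

end

section \<open>Riemann invariants of the wave equation\<close>

lemma at_within_Ici_neq_bot:
  assumes "(t :: real) \<ge> 0"
  shows "at t within {0..} \<noteq> bot"
proof -
  have "at_right t \<le> at t within {0..}"
    using assms by (intro at_le) auto
  then show ?thesis using trivial_limit_at_right_real[of t] bot.extremum_unique by metis
qed

lemma DERIV_within_Ici_unique: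
  assumes "(t :: real) \<ge> 0" "(f has_real_derivative D) (at t within {0..})"
    "(f has_real_derivative E) (at t within {0..})"
  shows "D = E"
  using vector_derivative_unique_within[OF at_within_Ici_neq_bot[OF assms(1)]] assms(2,3)
  by (auto simp: has_real_derivative_iff_has_vector_derivative)

lemma continuous_on_slice_x:
  fixes f :: "real \<Rightarrow> real \<Rightarrow> real"
  assumes "continuous_on (UNIV \<times> {0..}) (\<lambda>(x, t). f x t)" "t \<ge> 0"
  shows "continuous_on A (\<lambda>x. f x t)"
proof -
  have "continuous_on A (\<lambda>x. (\<lambda>(x, t). f x t) (x, t))"
    by (rule continuous_on_compose2[OF assms(1)]) (use assms(2) in \<open>auto intro!: continuous_intros\<close>)
  then show ?thesis by simp
qed

text \<open>\<open>smooth_xt\<close> supplies the time derivative of \<open>fx\<close>, whereas the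
  space derivative of \<open>ft\<close> is wanted. Writing \<open>f\<close> as an integral of
  \<open>fx\<close> and differentiating under the integral sign represents \<open>ft\<close> as an
  integral of \<open>fxt\<close>, which is then differentiated in \<open>x\<close>.\<close>

lemma mixed_partials:
  fixes f fx ft fxt :: "real \<Rightarrow> real \<Rightarrow> real"
  assumes fx: "\<And>x t. t \<ge> 0 \<Longrightarrow> ((\<lambda>y. f y t) has_real_derivative fx x t) (at x)"
    and ft: "\<And>x t. t \<ge> 0 \<Longrightarrow> (f x has_real_derivative ft x t) (at t within {0..})"
    and fxt: "\<And>x t. t \<ge> 0 \<Longrightarrow> (fx x has_real_derivative fxt x t) (at t within {0..})"
    and cfx: "continuous_on (UNIV \<times> {0..}) (\<lambda>(x, t). fx x t)"
    and cfxt: "continuous_on (UNIV \<times> {0..}) (\<lambda>(x, t). fxt x t)"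
    and t: "t \<ge> 0"
  shows "((\<lambda>y. ft y t) has_real_derivative fxt x t) (at x)"
proof -
  \<comment> \<open>Any base point strictly to the left of \<open>x\<close> serves; it makes
    \<open>x\<close> interior, so that the derivative becomes two-sided.\<close>
  let ?a = "x - 1" and ?b = "x + 1"
  have f_eq: "f y s = f ?a s + integral {?a..y} (\<lambda>z. fx z s)" if "s \<ge> 0" "y \<ge> ?a" for y s
  proof -
    have "((\<lambda>z. fx z s) has_integral (f y s - f ?a s)) {?a..y}"
      using that fx by (intro fundamental_theorem_of_calculus)
        (auto simp: has_real_derivative_iff_has_vector_derivative[symmetric] intro: has_field_derivative_at_within)
    then show ?thesis by (simp add: integral_unique)
  qed
  have ft_eq: "ft y t = ft ?a t + integral {?a..y} (\<lambda>z. fxt z t)" if y: "y \<ge> ?a" for y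
  proof (rule DERIV_within_Ici_unique[OF t ft[OF t]])
    have "continuous_on ({0..} \<times> cbox ?a y) (\<lambda>p. (\<lambda>(x, t). fxt x t) (snd p, fst p))"
      by (rule continuous_on_compose2[OF cfxt]) (auto intro!: continuous_intros)
    then have "((\<lambda>s. integral (cbox ?a y) (\<lambda>z. fx z s)) has_real_derivative
        integral (cbox ?a y) (\<lambda>z. fxt z t)) (at t within {0..})"
      using t fxt continuous_on_slice_x[OF cfx]
      by (intro leibniz_rule_field_derivative)
        (auto intro!: integrable_continuous_real simp: case_prod_unfold)
    then have "((\<lambda>s. f ?a s + integral {?a..y} (\<lambda>z. fx z s)) has_real_derivative
        ft ?a t + integral {?a..y} (\<lambda>z. fxt z t)) (at t within {0..})"
      using ft[OF t] by (intro DERIV_add) auto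
    then show "(f y has_real_derivative ft ?a t + integral {?a..y} (\<lambda>z. fxt z t)) (at t within {0..})"
    proof (rule has_field_derivative_transform_within[OF _ zero_less_one])
      show "f ?a s + integral {?a..y} (\<lambda>z. fx z s) = f y s" if "s \<in> {0..}" for s
        using that y by (intro f_eq[symmetric]) auto
    qed (use t in simp)
  qed
  have "((\<lambda>y. integral {?a..y} (\<lambda>z. fxt z t)) has_real_derivative fxt x t) (at x within {?a..?b})"
    by (rule integral_has_real_derivative[OF continuous_on_slice_x[OF cfxt t]]) simp
  then have "((\<lambda>y. integral {?a..y} (\<lambda>z. fxt z t)) has_real_derivative fxt x t) (at x)"
    by (simp add: at_within_Icc_at)
  from DERIV_add[OF DERIV_const this, of "ft ?a t"]
  have "((\<lambda>y. ft ?a t + integral {?a..y} (\<lambda>z. fxt z t)) has_real_derivative fxt x t) (at x)"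
    by simp
  then show ?thesis
    by (rule has_field_derivative_transform_within_open[of _ _ _ "{?a<..<?b}"]) (auto intro!: ft_eq[symmetric])
qed

text \<open>Along the line from \<open>(x + a * t, 0)\<close> to \<open>(x, t)\<close> the
  derivative of \<open>G\<close> is \<open>Gt - a * Gx\<close>, which is zero. The chain rule needs
  a total derivative, obtained from the partial derivatives and the continuity of \<open>Gt\<close>,
  also at the boundary \<open>t = 0\<close>.\<close>

lemma constant_along_characteristics:
  fixes G Gx Gt :: "real \<Rightarrow> real \<Rightarrow> real"
  assumes Gx: "\<And>x t. t \<ge> 0 \<Longrightarrow> ((\<lambda>y. G y t) has_real_derivative Gx x t) (at x)"
    and Gt: "\<And>x t. t \<ge> 0 \<Longrightarrow> (G x has_real_derivative Gt x t) (at t within {0..})"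
    and cont: "continuous_on (UNIV \<times> {0..}) (\<lambda>(x, t). Gt x t)"
    and eq: "\<And>x t. t \<ge> 0 \<Longrightarrow> Gt x t = a * Gx x t"
    and t: "t \<ge> 0"
  shows "G x t = G (x + a * t) 0"
proof -
  let ?\<phi> = "\<lambda>s. (x + a * (t - s), s)"
  have "((\<lambda>s. (\<lambda>(x, t). G x t) (?\<phi> s)) has_derivative (\<lambda>h. 0)) (at s within {0..})"
    if s: "s \<in> {0..}" for s
  proof -
    let ?y = "x + a * (t - s)"
    have "((\<lambda>(x, t). G x t) has_derivative
        (\<lambda>(tx, ty). Gx ?y s * tx + blinfun_apply (blinfun_mult_right (Gt ?y s)) ty))
        (at (?y, s) within UNIV \<times> {0..})"
    proof (rule has_derivative_partialsI)
      show "((\<lambda>x. G x s) has_derivative (*) (Gx ?y s)) (at ?y within UNIV)"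
        using Gx s by (auto simp: has_field_derivative_def)
      show "(G z has_derivative blinfun_apply (blinfun_mult_right (Gt z r))) (at r within {0..})"
        if "r \<in> {0..}" for z r
        using Gt that by (auto simp: has_field_derivative_def blinfun_mult_right.rep_eq)
      have "continuous_on (UNIV \<times> {0..}) (\<lambda>p. blinfun_mult_right ((\<lambda>(x, t). Gt x t) p))"
        by (intro continuous_on_compose2[OF linear_continuous_on[OF bounded_linear_blinfun_mult_right] cont]) auto
      then show "continuous (at (?y, s) within UNIV \<times> {0..}) (\<lambda>(x, t). blinfun_mult_right (Gt x t))"
        using s by (auto simp: continuous_on_eq_continuous_within case_prod_unfold)
    qed (use s in auto)
    then have "((\<lambda>(x, t). G x t) has_derivative (\<lambda>(tx, ty). Gx ?y s * tx + Gt ?y s * ty))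
        (at (?y, s) within UNIV \<times> {0..})"
      by (simp only: blinfun_mult_right.rep_eq)
    then have G: "((\<lambda>(x, t). G x t) has_derivative (\<lambda>(tx, ty). Gx ?y s * tx + Gt ?y s * ty))
        (at (?y, s) within ?\<phi> ` {0..})"
      by (rule has_derivative_subset) auto
    have "((\<lambda>s. x + a * (t - s)) has_real_derivative - a) (at s within {0..})"
      by (auto intro!: derivative_eq_intros)
    then have "((\<lambda>s. x + a * (t - s)) has_derivative (\<lambda>h. - (a * h))) (at s within {0..})"
      by (rule has_field_derivative_imp_has_derivative[THEN has_derivative_eq_rhs]) auto
    then have \<phi>: "(?\<phi> has_derivative (\<lambda>h. (- (a * h), h))) (at s within {0..})"
      by (rule has_derivative_Pair[OF _ has_derivative_ident])
    show ?thesis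
      using has_derivative_in_compose[OF \<phi> G] eq[of s ?y] s by (simp add: mult_ac)
  qed
  then have "(\<lambda>(x, t). G x t) (?\<phi> t) = (\<lambda>(x, t). G x t) (?\<phi> 0)"
    using t by (intro has_derivative_zero_unique[of "{0..}" "\<lambda>s. (\<lambda>(x, t). G x t) (?\<phi> s)"]) auto
  then show ?thesis by simp
qed

lemma smooth_xt_cont: "smooth_xt K u \<Longrightarrow> continuous_on (UNIV \<times> {0..}) (\<lambda>(x, t). u x t)"
  by (cases K) auto

lemma smooth_xt_initial_derivs:
  "smooth_xt n f \<Longrightarrow> \<exists>F. F 0 = (\<lambda>x. f x 0) \<and>
     (\<forall>j<n. \<forall>x. (F j has_real_derivative F (Suc j) x) (at x)) \<and> continuous_on UNIV (F n)"
proof (induction n arbitrary: f)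
  case 0
  then show ?case using continuous_on_slice_x[of f 0 UNIV] by (intro exI[of _ "\<lambda>j x. f x 0"]) simp
next
  case (Suc n)
  then obtain fx where fx: "\<forall>x. \<forall>t\<ge>0. ((\<lambda>y. f y t) has_real_derivative fx x t) (at x)" "smooth_xt n fx"
    by auto
  then obtain F where F: "F 0 = (\<lambda>x. fx x 0)" "continuous_on UNIV (F n)"
    "\<And>j x. j < n \<Longrightarrow> (F j has_real_derivative F (Suc j) x) (at x)"
    using Suc.IH by blast
  show ?case
  proof (intro exI conjI allI impI)
    let ?F = "case_nat (\<lambda>x. f x 0) F"
    show "(?F j has_real_derivative ?F (Suc j) x) (at x)" if "j < Suc n" for j x
      using that fx(1) F by (cases j) auto
  qed (use F in auto)
qed

lemma continuous_periodic_2pi_bounded: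
  assumes "continuous_on UNIV f" "periodic_2pi f"
  shows "\<exists>B. \<forall>x. \<bar>f x\<bar> \<le> B"
proof -
  have "bounded (f ` {0..2 * pi})"
    by (intro compact_imp_bounded compact_continuous_image continuous_on_subset[OF assms(1)]) auto
  then obtain B where B: "\<And>x. x \<in> {0..2 * pi} \<Longrightarrow> \<bar>f x\<bar> \<le> B"
    unfolding bounded_iff by (metis imageI real_norm_def)
  have per: "f (x + 2 * pi * of_int n) = f x" for x n
  proof (induction n rule: int_induct[where k = 0])
    case (step1 i)
    then show ?case using assms(2)[unfolded periodic_2pi_def, rule_format, of "x + 2 * pi * of_int i"]
      by (simp add: algebra_simps)
  next
    case (step2 i)
    then show ?case using assms(2)[unfolded periodic_2pi_def, rule_format, of "x + 2 * pi * of_int (i - 1)"]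
      by (simp add: algebra_simps)
  qed simp
  have "\<bar>f x\<bar> \<le> B" for x
  proof -
    define n where "n = \<lfloor>x / (2 * pi)\<rfloor>"
    have "of_int n \<le> x / (2 * pi)" "x / (2 * pi) < of_int n + 1"
      unfolding n_def by linarith+
    then have "x - 2 * pi * of_int n \<in> {0..2 * pi}"
      by (simp add: pos_le_divide_eq pos_divide_less_eq algebra_simps)
    then show ?thesis using B per[of "x - 2 * pi * of_int n" n] by fastforce
  qed
  then show ?thesis by blast
qed

text \<open>The defect of the identity vanishes at \<open>s = 0\<close>, and its derivative in
  \<open>s\<close> cancels once \<open>p\<close> and \<open>q\<close> are expressed through
  \<open>R\<close> and \<open>L\<close>. This avoids splitting \<open>u\<close> itself into
  travelling waves, which need not be periodic when the mean of \<open>u\<close> grows.\<close>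

lemma dalembert_of_riemann:
  fixes u p q :: "real \<Rightarrow> real \<Rightarrow> real" and R L :: "real \<Rightarrow> real"
  assumes c: "c > 0"
    and ux: "\<And>x t. t \<ge> 0 \<Longrightarrow> ((\<lambda>y. u y t) has_real_derivative p x t) (at x)"
    and ut: "\<And>x t. t \<ge> 0 \<Longrightarrow> (u x has_real_derivative q x t) (at t within {0..})"
    and R: "\<And>x t. t \<ge> 0 \<Longrightarrow> q x t + c * p x t = R (x + c * t)"
    and L: "\<And>x t. t \<ge> 0 \<Longrightarrow> q x t - c * p x t = L (x - c * t)"
    and s: "0 \<le> s" "s \<le> t"
  shows "u x (t + s) + u x (t - s) = u (x + c * s) t + u (x - c * s) t"
proof -
  let ?\<psi> = "\<lambda>s. u x (t + s) + u x (t - s) - u (x + c * s) t - u (x - c * s) t"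
  have t: "t \<ge> 0" using s by simp
  have q: "q y r = (R (y + c * r) + L (y - c * r)) / 2" if "r \<ge> 0" for y r
    using R[OF that, of y] L[OF that, of y] by simp
  have p: "c * p y r = (R (y + c * r) - L (y - c * r)) / 2" if "r \<ge> 0" for y r
    using R[OF that, of y] L[OF that, of y] by simp
  have "(?\<psi> has_real_derivative 0) (at r within {0..t})" if r: "r \<in> {0..t}" for r
  proof -
    have ut': "((\<lambda>s. u x (t + e * s)) has_real_derivative q x (t + e * r) * e) (at r within {0..t})"
      if e: "e = 1 \<or> e = - 1" for e
    proof -
      have "(u x has_real_derivative q x (t + e * r)) (at (t + e * r) within (\<lambda>s. t + e * s) ` {0..t})"
        using r t e by (intro has_field_derivative_subset[OF ut]) auto
      moreover have "((\<lambda>s. t + e * s) has_real_derivative e) (at r within {0..t})"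
        by (auto intro!: derivative_eq_intros)
      ultimately show ?thesis
        using DERIV_image_chain[of "u x" "q x (t + e * r)" "\<lambda>s. t + e * s" r "{0..t}" e]
        by (simp add: o_def)
    qed
    have ux': "((\<lambda>s. u (x + d * s) t) has_real_derivative p (x + d * r) t * d) (at r within {0..t})" for d
      by (rule DERIV_chain2[OF ux[OF t]]) (auto intro!: derivative_eq_intros)
    have "(?\<psi> has_real_derivative q x (t + r) + - q x (t - r) - p (x + c * r) t * c - p (x - c * r) t * - c)
        (at r within {0..t})"
      using ut'[of 1] ut'[of "- 1"] ux'[of c] ux'[of "- c"]
      by (intro DERIV_diff DERIV_add) simp_all
    moreover have "q x (t + r) + - q x (t - r) - p (x + c * r) t * c - p (x - c * r) t * - c = 0"
      using q[of "t + r" x] q[of "t - r" x] p[OF t, of "x + c * r"] p[OF t, of "x - c * r"] r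
      by (simp add: algebra_simps)
    ultimately show ?thesis by simp
  qed
  then have "\<exists>k. \<forall>r\<in>{0..t}. ?\<psi> r = k"
    by (intro has_field_derivative_zero_constant) auto
  then have "?\<psi> s = ?\<psi> 0" using s t by (metis atLeastAtMost_iff order_refl)
  then show ?thesis by simp
qed

text \<open>\<open>smooth_xt\<close> and \<open>wave_solution\<close> each provide their own
  derivatives. Uniqueness of derivatives identifies the two sets, so the wave equation holds for the
  derivatives that are known to be smooth.\<close>

lemma smooth_xt_wave_first_order:
  assumes "wave_solution c u" "smooth_xt (Suc (Suc n)) u"
  obtains p q px pt qt where
    "\<And>x t. t \<ge> 0 \<Longrightarrow> ((\<lambda>y. u y t) has_real_derivative p x t) (at x)"
    "\<And>x t. t \<ge> 0 \<Longrightarrow> (u x has_real_derivative q x t) (at t within {0..})"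
    "\<And>x t. t \<ge> 0 \<Longrightarrow> ((\<lambda>y. p y t) has_real_derivative px x t) (at x)"
    "\<And>x t. t \<ge> 0 \<Longrightarrow> ((\<lambda>y. q y t) has_real_derivative pt x t) (at x)"
    "\<And>x t. t \<ge> 0 \<Longrightarrow> (p x has_real_derivative pt x t) (at t within {0..})"
    "\<And>x t. t \<ge> 0 \<Longrightarrow> (q x has_real_derivative qt x t) (at t within {0..})"
    "\<And>x t. t \<ge> 0 \<Longrightarrow> qt x t = c\<^sup>2 * px x t"
    "continuous_on (UNIV \<times> {0..}) (\<lambda>(x, t). pt x t)"
    "continuous_on (UNIV \<times> {0..}) (\<lambda>(x, t). qt x t)"
    "smooth_xt (Suc n) p" "smooth_xt (Suc n) q"
proof -
  obtain p q where p: "\<forall>x. \<forall>t\<ge>0. ((\<lambda>y. u y t) has_real_derivative p x t) (at x)"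
    and q: "\<forall>x. \<forall>t\<ge>0. (u x has_real_derivative q x t) (at t within {0..})"
    and sm: "smooth_xt (Suc n) p" "smooth_xt (Suc n) q"
    using assms(2) unfolding smooth_xt.simps(2)[of "Suc n"] by blast
  obtain px pt where px: "\<forall>x. \<forall>t\<ge>0. ((\<lambda>y. p y t) has_real_derivative px x t) (at x)"
    and pt: "\<forall>x. \<forall>t\<ge>0. (p x has_real_derivative pt x t) (at t within {0..})"
    and spt: "smooth_xt n pt"
    using sm(1) unfolding smooth_xt.simps(2) by blast
  obtain qt where qt: "\<forall>x. \<forall>t\<ge>0. (q x has_real_derivative qt x t) (at t within {0..})"
    and sqt: "smooth_xt n qt"
    using sm(2) unfolding smooth_xt.simps(2) by blast
  obtain wx wxx wt wtt where w: "\<forall>x. \<forall>t\<ge>0.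
        ((\<lambda>y. u y t) has_real_derivative wx x t) (at x) \<and>
        ((\<lambda>y. wx y t) has_real_derivative wxx x t) (at x) \<and>
        (u x has_real_derivative wt x t) (at t within {0..}) \<and>
        (wt x has_real_derivative wtt x t) (at t within {0..}) \<and>
        wtt x t = c\<^sup>2 * wxx x t"
    using assms(1) unfolding wave_solution_def by blast
  have p_eq: "p x t = wx x t" and q_eq: "q x t = wt x t" if "t \<ge> 0" for x t
    using p q w that DERIV_unique DERIV_within_Ici_unique by blast+
  have eq: "qt x t = c\<^sup>2 * px x t" if t: "t \<ge> 0" for x t
  proof -
    have "((\<lambda>y. p y t) has_real_derivative wxx x t) (at x)"
      using w t by (simp add: p_eq)
    then have "px x t = wxx x t" using px t DERIV_unique by blast
    moreover have "(q x has_real_derivative wtt x t) (at t within {0..})"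
    proof (rule has_field_derivative_transform_within[OF _ zero_less_one])
      show "(wt x has_real_derivative wtt x t) (at t within {0..})" using w t by blast
    qed (use t q_eq in auto)
    then have "qt x t = wtt x t" using qt t DERIV_within_Ici_unique by blast
    ultimately show ?thesis using w t by simp
  qed
  have qx: "((\<lambda>y. q y t) has_real_derivative pt x t) (at x)" if "t \<ge> 0" for x t
    by (rule mixed_partials[of u p q pt])
      (use p q pt that smooth_xt_cont[OF sm(1)] smooth_xt_cont[OF spt] in auto)
  show ?thesis
    by (rule that[of p q px pt qt])
      (use p q px qx pt qt eq sm smooth_xt_cont[OF spt] smooth_xt_cont[OF sqt] in auto)
qed

text \<open>The combinations \<open>q + c * p\<close> and \<open>q - c * p\<close> of the first
  derivatives satisfy transport equations, hence are determined by their initial values.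
  \<open>R j\<close> and \<open>L j\<close> are the derivatives of order \<open>j\<close> of those
  initial values.\<close>

lemma wave_riemann_invariants:
  assumes c: "c > 0" and per: "\<forall>t\<ge>0. periodic_2pi (\<lambda>x. u x t)"
    and wave: "wave_solution c u" and smooth: "smooth_xt (Suc (Suc n)) u"
  obtains R L where
    "\<And>j x. j \<le> n \<Longrightarrow> (R j has_real_derivative R (Suc j) x) (at x)"
    "\<And>j x. j \<le> n \<Longrightarrow> (L j has_real_derivative L (Suc j) x) (at x)"
    "continuous_on UNIV (R (Suc n))" "continuous_on UNIV (L (Suc n))"
    "\<And>j. j \<le> Suc n \<Longrightarrow> periodic_2pi (R j)" "\<And>j. j \<le> Suc n \<Longrightarrow> periodic_2pi (L j)"
    "\<And>x t. t \<ge> 0 \<Longrightarrow> ((\<lambda>y. u y t) has_real_derivative (R 0 (x + c * t) - L 0 (x - c * t)) / (2 * c)) (at x)"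
    "\<And>x t s. 0 \<le> s \<Longrightarrow> s \<le> t \<Longrightarrow> u x (t + s) + u x (t - s) = u (x + c * s) t + u (x - c * s) t"
proof -
  obtain p q px pt qt where
    ux: "\<And>x t. t \<ge> 0 \<Longrightarrow> ((\<lambda>y. u y t) has_real_derivative p x t) (at x)" and
    ut: "\<And>x t. t \<ge> 0 \<Longrightarrow> (u x has_real_derivative q x t) (at t within {0..})" and
    px: "\<And>x t. t \<ge> 0 \<Longrightarrow> ((\<lambda>y. p y t) has_real_derivative px x t) (at x)" and
    qx: "\<And>x t. t \<ge> 0 \<Longrightarrow> ((\<lambda>y. q y t) has_real_derivative pt x t) (at x)" and
    pt: "\<And>x t. t \<ge> 0 \<Longrightarrow> (p x has_real_derivative pt x t) (at t within {0..})" and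
    qt: "\<And>x t. t \<ge> 0 \<Longrightarrow> (q x has_real_derivative qt x t) (at t within {0..})" and
    eq: "\<And>x t. t \<ge> 0 \<Longrightarrow> qt x t = c\<^sup>2 * px x t" and
    cont: "continuous_on (UNIV \<times> {0..}) (\<lambda>(x, t). pt x t)"
      "continuous_on (UNIV \<times> {0..}) (\<lambda>(x, t). qt x t)" and
    sm: "smooth_xt (Suc n) p" "smooth_xt (Suc n) q"
    by (rule smooth_xt_wave_first_order[OF wave smooth]) (rule that; assumption)
  \<comment> \<open>Both families of characteristics are treated at once: \<open>a\<close> is
    \<open>c\<close> or \<open>- c\<close>, and the wave equation involves only its square.\<close>
  have char: "q x t + a * p x t = q (x + a * t) 0 + a * p (x + a * t) 0"
    if a: "a\<^sup>2 = c\<^sup>2" and t: "t \<ge> 0" for a x t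
  proof (rule constant_along_characteristics[where G = "\<lambda>x t. q x t + a * p x t"
        and Gx = "\<lambda>x t. pt x t + a * px x t" and Gt = "\<lambda>x t. qt x t + a * pt x t"])
    show "continuous_on (UNIV \<times> {0..}) (\<lambda>(x, t). qt x t + a * pt x t)"
      using continuous_on_add[OF cont(2) continuous_on_mult_left[OF cont(1), of a]]
      by (simp add: case_prod_unfold)
    show "qt x t + a * pt x t = a * (pt x t + a * px x t)" if "t \<ge> 0" for x t
      using eq[OF that] a by (simp add: power2_eq_square algebra_simps)
  qed (auto intro!: DERIV_add DERIV_cmult px qx pt qt t)
  obtain P Q where P: "P 0 = (\<lambda>x. p x 0)" "continuous_on UNIV (P (Suc n))"
      "\<And>j x. j < Suc n \<Longrightarrow> (P j has_real_derivative P (Suc j) x) (at x)"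
    and Q: "Q 0 = (\<lambda>x. q x 0)" "continuous_on UNIV (Q (Suc n))"
      "\<And>j x. j < Suc n \<Longrightarrow> (Q j has_real_derivative Q (Suc j) x) (at x)"
    using smooth_xt_initial_derivs[OF sm(1)] smooth_xt_initial_derivs[OF sm(2)] by blast
  have per_family: "periodic_2pi (F j)"
    if "periodic_2pi (F 0)" "\<And>j x. j < Suc n \<Longrightarrow> (F j has_real_derivative F (Suc j) x) (at x)" "j \<le> Suc n"
    for F :: "nat \<Rightarrow> real \<Rightarrow> real" and j
    using that(3)
  proof (induction j)
    case (Suc j)
    have "F (Suc j) = deriv (F j)"
      by (rule ext) (metis DERIV_imp_deriv Suc.prems Suc_le_lessD that(2))
    then show ?case using Suc periodic_2pi_deriv by simp
  qed (use that in simp)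
  have "periodic_2pi (\<lambda>x. p x 0)"
  proof -
    have "(\<lambda>x. p x 0) = deriv (\<lambda>x. u x 0)"
      using ux[of 0] by (auto intro!: DERIV_imp_deriv[symmetric])
    then show ?thesis using per periodic_2pi_deriv by simp
  qed
  then have perP: "periodic_2pi (P j)" if "j \<le> Suc n" for j
    using per_family[of P j] P that by simp
  have "periodic_2pi (\<lambda>x. q x 0)"
    unfolding periodic_2pi_def
  proof
    fix x
    have "(u x has_real_derivative q (x + 2 * pi) 0) (at 0 within {0..})"
      by (rule has_field_derivative_transform_within[OF ut[of 0] zero_less_one])
        (use per in \<open>auto simp: periodic_2pi_def\<close>)
    then show "q (x + 2 * pi) 0 = q x 0"
      using ut[of 0 x] DERIV_within_Ici_unique by blast
  qed
  then have perQ: "periodic_2pi (Q j)" if "j \<le> Suc n" for j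
    using per_family[of Q j] Q that by simp
  define S where "S a j x = Q j x + a * P j x" for a j x
  have S_deriv: "(S a j has_real_derivative S a (Suc j) x) (at x)" if "j \<le> n" for a j x
    using P(3)[of j x] Q(3)[of j x] that unfolding S_def by (auto intro!: DERIV_add DERIV_cmult)
  have S_cont: "continuous_on UNIV (S a (Suc n))" for a
    unfolding S_def by (intro continuous_intros P Q)
  have S_per: "periodic_2pi (S a j)" if "j \<le> Suc n" for a j
    using perP[OF that] perQ[OF that] by (simp add: periodic_2pi_def S_def)
  have R: "q x t + c * p x t = S c 0 (x + c * t)"
    and L: "q x t - c * p x t = S (- c) 0 (x - c * t)" if "t \<ge> 0" for x t
    using char[OF _ that, of c x] char[OF _ that, of "- c" x] P(1) Q(1) by (simp_all add: S_def)
  show ?thesis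
  proof (rule that[of "S c" "S (- c)"])
    show "((\<lambda>y. u y t) has_real_derivative (S c 0 (x + c * t) - S (- c) 0 (x - c * t)) / (2 * c)) (at x)"
      if "t \<ge> 0" for x t
      using ux[OF that, of x] R[OF that, of x, symmetric] L[OF that, of x, symmetric] c by simp
    show "u x (t + s) + u x (t - s) = u (x + c * s) t + u (x - c * s) t" if "0 \<le> s" "s \<le> t" for x t s
      by (rule dalembert_of_riemann[OF c ux ut R L that])
  qed (use S_deriv S_cont S_per in auto)
qed

section \<open>Energy estimate\<close>

lemma piecewise_poly_jet_Suc_Suc:
  "piecewise_poly_jet d h (Suc (Suc k)) P \<longleftrightarrow> piecewise_poly_jet d h k P"
  by (simp add: piecewise_poly_jet_def node_def grid_offset_def)

text \<open>\<open>\<sigma>\<close> stands for \<open>c \<Delta>t / 2\<close>.\<close>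

fun scheme_jet :: "nat \<Rightarrow> real \<Rightarrow> real \<Rightarrow> (real \<Rightarrow> real) \<Rightarrow> (real \<Rightarrow> real) \<Rightarrow> nat \<Rightarrow> nat \<Rightarrow> real \<Rightarrow> real" where
  "scheme_jet m h \<sigma> f0 f1 0 = hermite_jet m h 0 f0"
| "scheme_jet m h \<sigma> f0 f1 (Suc 0) = hermite_jet m h 1 f1"
| "scheme_jet m h \<sigma> f0 f1 (Suc (Suc k)) = (\<lambda>j x.
     hermite_jet m h (Suc (Suc k)) (\<lambda>y. scheme_jet m h \<sigma> f0 f1 (Suc k) 0 (y + \<sigma>) +
       scheme_jet m h \<sigma> f0 f1 (Suc k) 0 (y - \<sigma>)) j x - scheme_jet m h \<sigma> f0 f1 k j x)"

text \<open>Order 0 of the jet recursion is the scheme itself. Hence the approximations may be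
  replaced by jets, whose derivatives of all orders obey the recursion at every point.\<close>

lemma scheme_jet_0:
  assumes p0: "p 0 = hermite_interp m h 0 f0" and p1: "p 1 = hermite_interp m h 1 f1"
    and step: "\<And>k x. k \<ge> 1 \<Longrightarrow> p (k + 1) x =
        hermite_interp m h (k + 1) (\<lambda>y. p k (y + \<sigma>) + p k (y - \<sigma>)) x - p (k - 1) x"
  shows "scheme_jet m h \<sigma> f0 f1 k 0 = p k"
proof (induction k rule: induct_nat_012)
  case (ge2 k)
  then show ?case
    using step[of "Suc k"] by (auto simp: hermite_jet_0)
qed (use p0 p1 in \<open>simp_all add: hermite_jet_0\<close>)

lemma nrm_le_const:
  assumes "loc_bdd_meas f" "\<And>x. \<bar>f x\<bar> \<le> B"
  shows "nrm (- pi) pi f \<le> sqrt (2 * pi) * B"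
proof -
  have "B \<ge> 0" using assms(2)[of 0] by linarith
  have "f x * f x \<le> B * B" for x
    using mult_mono[OF assms(2) assms(2), of x x] \<open>B \<ge> 0\<close> by (simp add: abs_mult[symmetric])
  then have "ip (- pi) pi f f \<le> integral {- pi..pi} (\<lambda>x. B * B)"
    unfolding ip_def by (intro integral_le ip_integrable assms(1) integrable_const_ivl) auto
  then have "nrm (- pi) pi f \<le> sqrt (2 * pi * (B * B))"
    by (simp add: nrm_def mult_ac)
  then show ?thesis using \<open>B \<ge> 0\<close> by (simp add: real_sqrt_mult)
qed

text \<open>Factoring the difference of squares and cancelling \<open>a + b\<close> turns a
  quadratic energy increment into a linear increment of its square root.\<close>

lemma sqrt_increment_bound:
  fixes a b d r :: real
  assumes "a \<ge> 0" "b \<ge> 0" "r \<ge> 0" "a\<^sup>2 \<le> b\<^sup>2 + 2 * d" "d \<le> (a + b) * r"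
  shows "a \<le> b + 2 * r"
proof (rule ccontr)
  assume "\<not> a \<le> b + 2 * r"
  then have "a - b > 2 * r" "a + b > 0" using assms by auto
  then have "(a + b) * (2 * r) < (a + b) * (a - b)" by (intro mult_strict_left_mono)
  then show False using assms(4,5) by (simp add: power2_eq_square algebra_simps)
qed

text \<open>\<open>U j\<close> stands for the derivative of order \<open>j\<close> in space of the
  exact solution. The constant \<open>M\<close> in \<open>U_lipschitz\<close> does not depend on
  time, which keeps the forcing per step uniform; time differences are centred, so their length is
  \<open>2 * s\<close>.\<close>

locale hermite_error = mesh +
  fixes m :: nat and c dt M :: real and U :: "nat \<Rightarrow> real \<Rightarrow> real \<Rightarrow> real" and f0 f1 :: "real \<Rightarrow> real"
  assumes dt: "dt > 0" and M: "M \<ge> 0"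
    and f0: "periodic_2pi f0" and f1: "periodic_2pi f1"
    and U_DERIV: "\<And>j x t. t \<ge> 0 \<Longrightarrow> j \<le> 2 * m + 1 \<Longrightarrow>
      ((\<lambda>y. U j y t) has_real_derivative U (Suc j) x t) (at x)"
    and U_cont: "\<And>t. t \<ge> 0 \<Longrightarrow> continuous_on UNIV (\<lambda>x. U (2 * m + 2) x t)"
    and U_periodic: "\<And>j t. t \<ge> 0 \<Longrightarrow> j \<le> 2 * m + 2 \<Longrightarrow> periodic_2pi (\<lambda>x. U j x t)"
    and U_dalembert: "\<And>j x t s. 0 \<le> s \<Longrightarrow> s \<le> t \<Longrightarrow>
      U j x (t + s) + U j x (t - s) = U j (x + c * s) t + U j (x - c * s) t"
    and U_lipschitz: "\<And>x t s. 0 \<le> s \<Longrightarrow> s \<le> t \<Longrightarrow>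
      \<bar>U (2 * m + 2) x (t + s) - U (2 * m + 2) x (t - s)\<bar> \<le> M * s"
begin

text \<open>Indices are shifted: \<open>Ep k\<close>, \<open>Em k\<close> stands for \<open>E\<^sub>\<plusminus>\<close> at level \<open>k + 1\<close>, and \<open>\<delta> k\<close>, \<open>\<omega> k\<close> belong to the
  step from level \<open>k + 1\<close> to \<open>k + 2\<close>.\<close>

definition "\<sigma> = c * (dt / 2)"
definition "P = scheme_jet m h \<sigma> f0 f1"
definition "e k j x = U j x (time_level dt k) - P k j x"
definition "\<delta> k j x = P (Suc k) j (x + \<sigma>) + P (Suc k) j (x - \<sigma>) -
  hermite_jet m h (Suc (Suc k)) (\<lambda>y. P (Suc k) 0 (y + \<sigma>) + P (Suc k) 0 (y - \<sigma>)) j x"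
definition "Ep k j x = e (Suc k) j x - e k j (x + \<sigma>)"
definition "Em k j x = e (Suc k) j x - e k j (x - \<sigma>)"
definition "V k j x = U j x (time_level dt (Suc (Suc k))) - U j x (time_level dt k)"
definition "\<omega> k j x = V k j x - hermite_jet m h (Suc (Suc k)) (V k 0) j x"

abbreviation "N \<equiv> nrm (- pi) pi"
abbreviation "IP \<equiv> ip (- pi) pi"

text \<open>The square root of the error energy at level k + 1.\<close>

definition "a k = sqrt ((N (Ep k (Suc m)))\<^sup>2 + (N (Em k (Suc m)))\<^sup>2)"

lemma P_Suc_Suc: "P (Suc (Suc k)) j x = hermite_jet m h (Suc (Suc k))
    (\<lambda>y. P (Suc k) 0 (y + \<sigma>) + P (Suc k) 0 (y - \<sigma>)) j x - P k j x"
  by (simp add: P_def)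

lemma jet_two_shifts: "jet m F \<Longrightarrow> jet m (\<lambda>j x. F j (x + \<sigma>) + F j (x - \<sigma>))"
  using jet_shift[of m F \<sigma>] jet_shift[of m F "- \<sigma>"] by (auto intro: jet_add)

lemma jet_P: "jet m (P k)"
proof (induction k rule: induct_nat_012)
  case (ge2 k)
  show ?case
    unfolding P_Suc_Suc[abs_def]
    using jet_periodic[OF jet_two_shifts[OF ge2(2)], of 0] by (intro jet_diff jet_hermite_jet ge2(1)) simp
qed (simp_all add: P_def jet_hermite_jet f0 f1)

lemma piecewise_poly_jet_P: "piecewise_poly_jet (2 * m + 1) h k (P k)"
proof (induction k rule: induct_nat_012)
  case (ge2 k)
  then show ?case
    unfolding P_Suc_Suc[abs_def]
    by (intro piecewise_poly_jet_diff piecewise_poly_jet_hermite)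
       (simp add: piecewise_poly_jet_Suc_Suc)
qed (use piecewise_poly_jet_hermite[of m 0 f0] piecewise_poly_jet_hermite[of m 1 f1]
      in \<open>simp_all add: P_def\<close>)

lemma time_level_nonneg: "time_level dt k \<ge> 0"
  using dt by (simp add: time_level_def)

lemma jet_U:
  assumes "t \<ge> 0"
  shows "jet m (\<lambda>j x. U j x t)"
proof -
  have c: "continuous_on UNIV (\<lambda>x. U j x t)" if "j \<le> Suc m" for j
  proof (cases "j \<le> 2 * m + 1")
    case True
    then show ?thesis using U_DERIV[OF assms, of j]
      by (auto intro!: continuous_at_imp_continuous_on DERIV_isCont)
  next
    case False
    then show ?thesis using U_cont[OF assms] that by auto
  qed
  then show ?thesis
    unfolding jet_def using U_DERIV[OF assms] U_periodic[OF assms]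
    by (auto intro!: exI[of _ "{}"] loc_bdd_meas_cont simp: locally_finite_def)
qed

lemma jet_e: "jet m (e k)"
  unfolding e_def[abs_def] by (intro jet_diff jet_U jet_P time_level_nonneg)

lemma jet_Ep: "jet m (Ep k)"
  unfolding Ep_def[abs_def] by (intro jet_diff jet_shift jet_e)

lemma jet_Em: "jet m (Em k)"
  using jet_diff[OF jet_e jet_shift[OF jet_e, of _ "- \<sigma>"], of "Suc k" k]
  by (simp add: Em_def[abs_def])

lemma jet_\<delta>: "jet m (\<delta> k)"
  and vanishes_\<delta>: "vanishes_at_nodes m (Suc (Suc k)) (\<delta> k)"
  unfolding \<delta>_def[abs_def]
  by (rule jet_interp_error[OF jet_two_shifts[OF jet_P]]
      vanishes_interp_error[OF jet_two_shifts[OF jet_P]])+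

lemma jet_V: "jet m (V k)"
  unfolding V_def[abs_def] by (intro jet_diff jet_U time_level_nonneg)

lemma jet_\<omega>: "jet m (\<omega> k)"
  unfolding \<omega>_def[abs_def] by (rule jet_interp_error[OF jet_V])

lemmas meas = jet_loc_bdd_meas[OF jet_Ep] jet_loc_bdd_meas[OF jet_Em] jet_loc_bdd_meas[OF jet_\<delta>]
  jet_loc_bdd_meas[OF jet_e] jet_loc_bdd_meas[OF jet_V] jet_loc_bdd_meas[OF jet_P]
  jet_loc_bdd_meas[OF jet_\<omega>]

lemma time_level_Suc: "time_level dt (Suc k) = time_level dt k + dt / 2"
  by (simp add: time_level_def field_simps)

text \<open>The exact solution satisfies the two-step relation without remainder, by the d'Alembert
  identity centred at level k + 1; the part of the shifted approximations removed by interpolation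
  remains as \<open>\<delta>\<close>.\<close>

lemma error_recursion:
  "e (Suc (Suc k)) j x + e k j x = e (Suc k) j (x + \<sigma>) + e (Suc k) j (x - \<sigma>) + \<delta> k j x"
  using U_dalembert[of "dt / 2" "time_level dt (Suc k)" j x] time_level_nonneg[of k] dt
  by (simp add: e_def \<delta>_def P_Suc_Suc \<sigma>_def time_level_Suc)

lemma Ep_Suc: "Ep (Suc k) j x = Ep k j (x - \<sigma>) + \<delta> k j x"
  using error_recursion[of k j x] by (simp add: Ep_def)

lemma Em_Suc: "Em (Suc k) j x = Em k j (x + \<sigma>) + \<delta> k j x"
  using error_recursion[of k j x] by (simp add: Em_def)

lemma N_shift: "jet m F \<Longrightarrow> j \<le> Suc m \<Longrightarrow> N (\<lambda>x. F j (x + s)) = N (F j)"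
  by (intro nrm_shift jet_loc_bdd_meas jet_periodic)

lemma N_Ep_shift: "j \<le> Suc m \<Longrightarrow> N (\<lambda>x. Ep k j (x - \<sigma>)) = N (Ep k j)"
  using N_shift[OF jet_Ep, of j k "- \<sigma>"] by simp

lemma N_Em_shift: "j \<le> Suc m \<Longrightarrow> N (\<lambda>x. Em k j (x + \<sigma>)) = N (Em k j)"
  by (rule N_shift[OF jet_Em])

lemma a_nonneg: "a k \<ge> 0"
  by (simp add: a_def)

text \<open>The source is the difference between the new \<open>Ep\<close> and the transported old
  one, and each is controlled by its energy. The bound thus needs no regularity of the
  approximations.\<close>

lemma N_\<delta>_le: "N (\<delta> k (Suc m)) \<le> a (Suc k) + a k"
proof -
  have "\<delta> k (Suc m) = (\<lambda>x. Ep (Suc k) (Suc m) x - Ep k (Suc m) (x - \<sigma>))"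
    by (simp add: Ep_Suc)
  then have le: "N (\<delta> k (Suc m)) \<le> N (Ep (Suc k) (Suc m)) + N (\<lambda>x. Ep k (Suc m) (x - \<sigma>))"
    using nrm_triangle_diff[OF meas(1)[OF order_refl, of "Suc k"], of "\<lambda>x. Ep k (Suc m) (x - \<sigma>)"]
      jet_loc_bdd_meas[OF jet_shift[OF jet_Ep, of _ "- \<sigma>"], of "Suc m" k] by simp
  have Ep_le: "N (Ep k (Suc m)) \<le> a k" for k
    unfolding a_def by (rule real_le_rsqrt) simp
  show ?thesis
    using le N_Ep_shift[OF order_refl, of k] Ep_le[of k] Ep_le[of "Suc k"] by linarith
qed

lemma energy_identity: "(a (Suc k))\<^sup>2 = (a k)\<^sup>2 + 2 * IP (\<delta> k (Suc m)) (\<omega> k (Suc m))"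
proof -
  let ?A = "\<lambda>x. Ep k (Suc m) (x - \<sigma>)" and ?B = "\<lambda>x. Em k (Suc m) (x + \<sigma>)"
    and ?D = "\<delta> k (Suc m)"
  have mA: "loc_bdd_meas ?A"
    using jet_loc_bdd_meas[OF jet_shift[OF jet_Ep, of _ "- \<sigma>"], of "Suc m" k] by simp
  have mB: "loc_bdd_meas ?B" by (rule jet_loc_bdd_meas[OF jet_shift[OF jet_Em] order_refl])
  have mD: "loc_bdd_meas ?D" by (rule meas(3)[OF order_refl])
  have sq: "(N (\<lambda>x. f x + ?D x))\<^sup>2 = (N f)\<^sup>2 + 2 * IP ?D f + IP ?D ?D" if "loc_bdd_meas f" for f
    using that mD
    by (simp add: nrm_sq loc_bdd_meas_add ip_add_left ip_add_right ip_commute[of _ _ f ?D])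
  \<comment> \<open>By the error recursion the sum is \<open>e\<close> at level k + 2 minus
    \<open>e\<close> at level \<open>k\<close>, that is, the difference \<open>V\<close> of exact
    values minus a difference of approximations on the same grid.\<close>
  have AB: "(\<lambda>x. ?A x + ?B x + ?D x) = (\<lambda>x. V k (Suc m) x - (P (Suc (Suc k)) (Suc m) x - P k (Suc m) x))"
    using error_recursion[of k "Suc m"] by (auto simp: Ep_def Em_def e_def V_def fun_eq_iff algebra_simps)
  have "(a (Suc k))\<^sup>2 = (N (\<lambda>x. ?A x + ?D x))\<^sup>2 + (N (\<lambda>x. ?B x + ?D x))\<^sup>2"
    by (simp add: a_def Ep_Suc[abs_def] Em_Suc[abs_def])
  \<comment> \<open>Each of the two squares contributes one copy of \<open>IP ?D ?D\<close>, which
    accounts for the common factor 2.\<close>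
  also have "\<dots> = (a k)\<^sup>2 + 2 * (IP ?D ?A + IP ?D ?B + IP ?D ?D)"
    by (simp add: sq mA mB a_def N_Ep_shift N_Em_shift)
  also have "IP ?D ?A + IP ?D ?B + IP ?D ?D = IP ?D (\<lambda>x. ?A x + ?B x + ?D x)"
    using mA mB mD by (simp add: ip_add_right loc_bdd_meas_add)
  also have "\<dots> = IP ?D (V k (Suc m))"
  proof -
    let ?Q = "\<lambda>j x. P (Suc (Suc k)) j x - P k j x"
    have Q: "jet m ?Q" by (intro jet_diff jet_P)
    have "piecewise_poly_jet (2 * m + 1) h (Suc (Suc k)) ?Q"
      using piecewise_poly_jet_P[of k] piecewise_poly_jet_P[of "Suc (Suc k)"]
      by (intro piecewise_poly_jet_diff) (simp_all add: piecewise_poly_jet_Suc_Suc)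
    then have "IP ?D (?Q (Suc m)) = 0"
      by (intro ip_piecewise_poly_eq_0[OF jet_\<delta> vanishes_\<delta>] Q)
    then show ?thesis
      unfolding AB using ip_diff_right[OF meas(5)[OF order_refl] jet_loc_bdd_meas[OF Q order_refl] mD] by simp
  qed
  \<comment> \<open>Subtracting the interpolant of \<open>V\<close> changes nothing, as
    \<open>\<delta>\<close> is orthogonal to it, and leaves a quantity of order
    \<open>h ^ Suc m\<close>.\<close>
  also have "\<dots> = IP ?D (\<omega> k (Suc m))"
  proof -
    have H: "jet m (hermite_jet m h (Suc (Suc k)) (V k 0))"
      by (intro jet_hermite_jet jet_periodic[OF jet_V]) simp
    show ?thesis
      unfolding \<omega>_def[abs_def]
      using ip_diff_right[OF meas(5)[OF order_refl] jet_loc_bdd_meas[OF H order_refl] mD]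
        ip_piecewise_poly_eq_0[OF jet_\<delta> vanishes_\<delta> piecewise_poly_jet_hermite H] by simp
  qed
  finally show ?thesis .
qed

section \<open>Growth of the energy and accumulation of the error\<close>

definition "r = h ^ Suc m * (sqrt (2 * pi) * (M * (dt / 2)))"

lemma r_nonneg: "r \<ge> 0"
  using h_pos M dt by (simp add: r_def)

lemma N_\<omega>_le: "N (\<omega> k (Suc m)) \<le> r"
proof -
  have t: "time_level dt (Suc (Suc k)) = time_level dt (Suc k) + dt / 2"
    "time_level dt k = time_level dt (Suc k) - dt / 2"
    by (simp_all add: time_level_Suc)
  have cont: "continuous_on UNIV (V k (2 * m + 2))"
    unfolding V_def[abs_def] by (intro continuous_on_diff U_cont time_level_nonneg)
  have "N (\<omega> k (Suc m)) \<le> h ^ Suc m * N (V k (2 * m + 2))"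
    unfolding \<omega>_def[abs_def]
  proof (rule nrm_interp_error[where V = "V k" and m = m])
    show "(V k j has_real_derivative V k (Suc j) x) (at x)" if "j \<le> 2 * m + 1" for j x
      unfolding V_def[abs_def] by (intro DERIV_diff U_DERIV time_level_nonneg that)
    show "periodic_2pi (V k j)" if "j \<le> 2 * m + 2" for j
      using U_periodic[OF time_level_nonneg that] by (simp add: V_def periodic_2pi_def)
  qed (rule cont)
  also have "N (V k (2 * m + 2)) \<le> sqrt (2 * pi) * (M * (dt / 2))"
    using U_lipschitz[of "dt / 2" "time_level dt (Suc k)"] dt time_level_nonneg[of k]
    by (intro nrm_le_const loc_bdd_meas_cont cont) (simp add: V_def t)
  finally show ?thesis using h_pos by (simp add: r_def)
qed

text \<open>The increment of the squared energy root is at most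
  \<open>2 * (a (Suc k) + a k) * r\<close>, so the root itself grows by at most \<open>2 * r\<close>
  per half step.\<close>

lemma a_le: "a k \<le> a 0 + real k * (2 * r)"
proof (induction k)
  case (Suc k)
  have "IP (\<delta> k (Suc m)) (\<omega> k (Suc m)) \<le> N (\<delta> k (Suc m)) * N (\<omega> k (Suc m))"
    using abs_ip_le_nrm[OF meas(3)[OF order_refl] meas(7)[OF order_refl], of "- pi" pi k k] by linarith
  also have "\<dots> \<le> (a (Suc k) + a k) * r"
    using a_nonneg[of k] a_nonneg[of "Suc k"]
    by (intro mult_mono N_\<delta>_le N_\<omega>_le nrm_nonneg meas) auto
  finally have "a (Suc k) \<le> a k + 2 * r"
    by (rule sqrt_increment_bound[OF a_nonneg a_nonneg r_nonneg eq_refl[OF energy_identity]])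
  then show ?case using Suc by (simp add: algebra_simps)
qed simp

lemma N_Ep_le: "N (Ep k 0) \<le> N (Ep 0 0) + real k * (h ^ Suc m * (2 * a 0 + real k * (4 * r)))"
proof (induction k)
  case (Suc k)
  have "N (Ep (Suc k) 0) \<le> N (\<lambda>x. Ep k 0 (x - \<sigma>)) + N (\<delta> k 0)"
    unfolding Ep_Suc[abs_def]
    using jet_loc_bdd_meas[OF jet_shift[OF jet_Ep, of _ "- \<sigma>"], of 0 k]
    by (intro nrm_triangle meas) auto
  also have "N (\<delta> k 0) \<le> h ^ Suc m * N (\<delta> k (Suc m))"
    by (rule nrm_poincare[OF jet_\<delta> vanishes_\<delta>])
  \<comment> \<open>The two energy roots sum to at most
    \<open>2 * a 0 + (2 * k + 1) * (2 * r)\<close>, and 2k + 1 is rounded up to 2(k + 1).\<close>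
  also have "N (\<delta> k (Suc m)) \<le> 2 * a 0 + real (Suc k) * (4 * r)"
    using N_\<delta>_le[of k] a_le[of k] a_le[of "Suc k"] r_nonneg by (simp add: algebra_simps)
  finally have "N (Ep (Suc k) 0) \<le> N (Ep k 0) + h ^ Suc m * (2 * a 0 + real (Suc k) * (4 * r))"
    using h_pos N_Ep_shift[of 0 k] by simp
  also have "\<dots> \<le> N (Ep 0 0) + real k * (h ^ Suc m * (2 * a 0 + real (Suc k) * (4 * r)))
      + h ^ Suc m * (2 * a 0 + real (Suc k) * (4 * r))"
  proof -
    have "real k * (h ^ Suc m * (2 * a 0 + real k * (4 * r)))
        \<le> real k * (h ^ Suc m * (2 * a 0 + real (Suc k) * (4 * r)))"
      using h_pos r_nonneg by (intro mult_left_mono add_left_mono mult_right_mono) auto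
    then show ?thesis using Suc by linarith
  qed
  finally show ?case by (simp add: algebra_simps)
qed simp

text \<open>The error at the next level is \<open>Ep\<close> plus a shift of the present error, and
  shifts preserve the norm. The bounds for \<open>Ep\<close> are therefore summed, each replaced by
  the largest, last one.\<close>

lemma N_e_le:
  "N (e k 0) \<le> N (e 0 0) + real k * (N (Ep 0 0) + real k * (h ^ Suc m * (2 * a 0 + real k * (4 * r))))"
proof (induction k)
  case (Suc k)
  let ?B = "\<lambda>n. N (Ep 0 0) + real n * (h ^ Suc m * (2 * a 0 + real n * (4 * r)))"
  have mono: "?B k \<le> ?B (Suc k)"
    using h_pos r_nonneg a_nonneg[of 0]
    by (intro add_left_mono mult_mono) (auto intro!: add_nonneg_nonneg mult_nonneg_nonneg)
  have "e (Suc k) 0 = (\<lambda>x. Ep k 0 x + e k 0 (x + \<sigma>))"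
    by (simp add: Ep_def)
  then have "N (e (Suc k) 0) \<le> N (Ep k 0) + N (\<lambda>x. e k 0 (x + \<sigma>))"
    using nrm_triangle[OF meas(1) jet_loc_bdd_meas[OF jet_shift[OF jet_e]], of 0 0] by simp
  also have "\<dots> = N (Ep k 0) + N (e k 0)"
    using N_shift[OF jet_e, of 0] by simp
  also have "\<dots> \<le> ?B (Suc k) + (N (e 0 0) + real k * ?B (Suc k))"
    using N_Ep_le[of k] Suc mono mult_left_mono[OF mono, of "real k"] by linarith
  finally show ?case by (simp add: algebra_simps)
qed simp

end

section \<open>Convergence\<close>

text \<open>Every term is \<open>h ^ (2 * m)\<close> times a monomial of degree at most 3 in
  \<open>y = k * h\<close>. The lower bound on \<open>dt\<close> gives
  \<open>y \<le> \<kappa> * t\<close>, where the 2 in \<open>\<kappa>\<close> comes from half steps;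
  the CFL condition enters as \<open>dt \<le> h / c\<close> and produces
  \<open>\<mu>\<close>.\<close>

lemma error_rate_arithmetic:
  fixes h dt c \<eta> M C a0 b0 e0 E r t :: real and k m :: nat
  assumes h: "h > 0" "h \<le> 2 * pi" and c: "c > 0" and \<eta>: "\<eta> > 0" and M: "M \<ge> 0" and C: "C \<ge> 0"
    and dt: "\<eta> * h / c \<le> dt" "c * dt < h"
    and a0: "a0 \<le> sqrt C * h ^ Suc m" and b0: "b0 \<le> 2 * C * h ^ (2 * m + 1)"
    and e0: "e0 \<le> C * h ^ (2 * m + 1)"
    and r: "r = h ^ Suc m * (sqrt (2 * pi) * (M * (dt / 2)))"
    and E: "E \<le> e0 + real k * (b0 + real k * (h ^ Suc m * (2 * a0 + real k * (4 * r))))"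
    and t: "t = real k / 2 * dt"
    and \<kappa>: "\<kappa> = 2 * c / \<eta>" and \<mu>: "\<mu> = sqrt (2 * pi) * M / (2 * c)"
  shows "E \<le> (2 * pi * C + 2 * C * \<kappa> + 2 * sqrt C * \<kappa>\<^sup>2 + 4 * \<mu> * \<kappa> ^ 3) * h ^ (2 * m) * (1 + t ^ 3)"
proof -
  define y where "y = real k * h"
  have y: "y \<ge> 0" using h by (simp add: y_def)
  have dt0: "dt > 0" using dt(1) h c \<eta> by (smt (verit) divide_pos_pos mult_pos_pos)
  then have t0: "t \<ge> 0" by (simp add: t)
  have \<kappa>0: "\<kappa> \<ge> 0" and \<mu>0: "\<mu> \<ge> 0" using c \<eta> M by (simp_all add: \<kappa> \<mu>)
  have "h \<le> c * dt / \<eta>" using dt(1) c \<eta> by (simp add: field_simps)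
  then have "y \<le> real k * (c * dt / \<eta>)" unfolding y_def by (intro mult_left_mono) auto
  then have y_le: "y \<le> \<kappa> * t" using \<eta> by (simp add: \<kappa> t mult_ac)
  have "dt \<le> h / c" using dt(2) c by (simp add: field_simps)
  then have "sqrt (2 * pi) * (M * (dt / 2)) \<le> sqrt (2 * pi) * (M * (h / c / 2))"
    using M by (intro mult_left_mono) auto
  then have r_le: "r \<le> h ^ Suc m * (\<mu> * h)"
    unfolding r using h by (intro mult_left_mono) (auto simp: \<mu> mult_ac)
  \<comment> \<open>The initial error is better than needed by one power of \<open>h\<close>, which
    is bounded by the length 2 pi of the period.\<close>
  have "e0 \<le> (C * h ^ (2 * m)) * (2 * pi)"
    using e0 mult_left_mono[OF h(2), of "C * h ^ (2 * m)"] C h by (simp add: mult_ac)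
  moreover have "real k * b0 \<le> real k * (2 * C * h ^ (2 * m + 1))"
    using b0 by (intro mult_left_mono) auto
  moreover have "real k * (real k * (h ^ Suc m * (2 * a0))) \<le> real k * (real k * (h ^ Suc m * (2 * (sqrt C * h ^ Suc m))))"
    using a0 h by (intro mult_left_mono) auto
  moreover have "real k * (real k * (h ^ Suc m * (real k * (4 * r))))
      \<le> real k * (real k * (h ^ Suc m * (real k * (4 * (h ^ Suc m * (\<mu> * h))))))"
    using r_le h by (intro mult_left_mono) auto
  ultimately have "E \<le> (C * h ^ (2 * m)) * (2 * pi) + real k * (2 * C * h ^ (2 * m + 1))
      + real k * (real k * (h ^ Suc m * (2 * (sqrt C * h ^ Suc m))))
      + real k * (real k * (h ^ Suc m * (real k * (4 * (h ^ Suc m * (\<mu> * h))))))"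
    using E by (simp only: distrib_left)
  also have "\<dots> = h ^ (2 * m) * (2 * pi * C + 2 * C * y + 2 * sqrt C * y\<^sup>2 + 4 * \<mu> * y ^ 3)"
    by (simp add: y_def power_mult_distrib power_mult power2_eq_square power3_eq_cube algebra_simps)
  also have "2 * pi * C + 2 * C * y + 2 * sqrt C * y\<^sup>2 + 4 * \<mu> * y ^ 3 \<le>
      2 * pi * C * (1 + t ^ 3) + 2 * C * (\<kappa> * (1 + t ^ 3)) + 2 * sqrt C * (\<kappa>\<^sup>2 * (1 + t ^ 3)) + 4 * \<mu> * (\<kappa> ^ 3 * (1 + t ^ 3))"
  proof -
    \<comment> \<open>Lower powers of \<open>t\<close> are absorbed by 1 for
      \<open>t \<le> 1\<close> and by the cube otherwise.\<close>
    have t_le: "t ^ n \<le> 1 + t ^ 3" if "n \<le> 3" for n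
    proof (cases "t \<le> 1")
      case True
      then have "t ^ n \<le> 1" using t0 by (simp add: power_le_one)
      then show ?thesis using zero_le_power[OF t0, of 3] by linarith
    next
      case False
      then have "t ^ n \<le> t ^ 3" using that by (intro power_increasing) auto
      then show ?thesis by simp
    qed
    have y_pow: "y ^ n \<le> \<kappa> ^ n * (1 + t ^ 3)" if "n \<le> 3" for n
    proof -
      have "y ^ n \<le> (\<kappa> * t) ^ n" by (rule power_mono[OF y_le y])
      also have "\<dots> \<le> \<kappa> ^ n * (1 + t ^ 3)"
        unfolding power_mult_distrib using t_le[OF that] \<kappa>0 by (intro mult_left_mono) auto
      finally show ?thesis .
    qed
    have "2 * pi * C * 1 \<le> 2 * pi * C * (1 + t ^ 3)"
      using C t0 by (intro mult_left_mono) auto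
    moreover have "2 * C * y \<le> 2 * C * (\<kappa> * (1 + t ^ 3))"
      using C y_pow[of 1] by (intro mult_left_mono) auto
    moreover have "2 * sqrt C * y\<^sup>2 \<le> 2 * sqrt C * (\<kappa>\<^sup>2 * (1 + t ^ 3))"
      using C y_pow[of 2] by (intro mult_left_mono) auto
    moreover have "4 * \<mu> * y ^ 3 \<le> 4 * \<mu> * (\<kappa> ^ 3 * (1 + t ^ 3))"
      using \<mu>0 y_pow[of 3] by (intro mult_left_mono) auto
    ultimately show ?thesis by linarith
  qed
  finally show ?thesis using h by (simp add: algebra_simps)
qed

lemma lipschitz_of_bounded_deriv:
  fixes f f' :: "real \<Rightarrow> real"
  assumes "\<And>x. (f has_real_derivative f' x) (at x)" "\<And>x. \<bar>f' x\<bar> \<le> B"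
  shows "\<bar>f x - f y\<bar> \<le> B * \<bar>x - y\<bar>"
  using field_differentiable_bound[of UNIV f f' B x y] assms by auto

text \<open>In terms of the Riemann invariants, \<open>\<partial>\<^sub>x\<^sup>j u\<close> for \<open>j \<ge> 1\<close>. Its \<open>t\<close>-Lipschitz constant is
  uniform in time although \<open>u\<close> itself may grow linearly.\<close>

definition wave_jet :: "real \<Rightarrow> (real \<Rightarrow> real \<Rightarrow> real) \<Rightarrow> (nat \<Rightarrow> real \<Rightarrow> real) \<Rightarrow> (nat \<Rightarrow> real \<Rightarrow> real)
    \<Rightarrow> nat \<Rightarrow> real \<Rightarrow> real \<Rightarrow> real" where
  "wave_jet c u R L j x t = (case j of 0 \<Rightarrow> u x t | Suc i \<Rightarrow> (R i (x + c * t) - L i (x - c * t)) / (2 * c))"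

theorem theorem2:
  fixes m :: nat
  shows "\<exists>K::nat. \<forall>(c::real) (\<eta>::real) (C0::real) (u::real \<Rightarrow> real \<Rightarrow> real).
    c > 0 \<longrightarrow> \<eta> > 0 \<longrightarrow>
    (\<forall>t\<ge>0. periodic_2pi (\<lambda>x. u x t)) \<longrightarrow> wave_solution c u \<longrightarrow> smooth_xt K u \<longrightarrow>
    (\<exists>C::real. \<forall>(nx::nat) (h::real) (dt::real) (p::nat \<Rightarrow> real \<Rightarrow> real).
       nx \<ge> 1 \<longrightarrow> h = 2 * pi / real nx \<longrightarrow> \<eta> * h / c \<le> dt \<longrightarrow> c * dt < h \<longrightarrow>
       conservative_hermite m c h dt p \<longrightarrow>
       l2norm (err u dt p 0) \<le> C0 * h ^ (2 * m + 1) \<longrightarrow>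
       l2norm (err u dt p 1) \<le> C0 * h ^ (2 * m + 1) \<longrightarrow>
       err_energy (m + 1) u c dt p 1 \<le> C0 * h ^ (2 * m + 2) \<longrightarrow>
       (\<forall>k. l2norm (err u dt p k) \<le> C * h ^ (2 * m) * (1 + time_level dt k ^ 3)))"
proof (intro exI[of _ "2 * m + 3"] allI impI)
  fix c \<eta> C0 :: real and u :: "real \<Rightarrow> real \<Rightarrow> real"
  assume c: "c > 0" and \<eta>: "\<eta> > 0" and per: "\<forall>t\<ge>0. periodic_2pi (\<lambda>x. u x t)"
    and wave: "wave_solution c u" and smooth: "smooth_xt (2 * m + 3) u"
  \<comment> \<open>The interpolation estimate uses 2m + 2 space derivatives, and their Lipschitz
    bound in time costs one more, hence 2m + 3.\<close>
  have "smooth_xt (Suc (Suc (2 * m + 1))) u" using smooth by (simp add: numeral_3_eq_3)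
  then obtain R L where
    R: "\<And>j x. j \<le> 2 * m + 1 \<Longrightarrow> (R j has_real_derivative R (Suc j) x) (at x)" and
    L: "\<And>j x. j \<le> 2 * m + 1 \<Longrightarrow> (L j has_real_derivative L (Suc j) x) (at x)" and
    cont: "continuous_on UNIV (R (Suc (2 * m + 1)))" "continuous_on UNIV (L (Suc (2 * m + 1)))" and
    perR: "\<And>j. j \<le> Suc (2 * m + 1) \<Longrightarrow> periodic_2pi (R j)" and
    perL: "\<And>j. j \<le> Suc (2 * m + 1) \<Longrightarrow> periodic_2pi (L j)" and
    ux: "\<And>x t. t \<ge> 0 \<Longrightarrow> ((\<lambda>y. u y t) has_real_derivative (R 0 (x + c * t) - L 0 (x - c * t)) / (2 * c)) (at x)" and
    dalembert: "\<And>x t s. 0 \<le> s \<Longrightarrow> s \<le> t \<Longrightarrow> u x (t + s) + u x (t - s) = u (x + c * s) t + u (x - c * s) t"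
    by (rule wave_riemann_invariants[OF c per wave]) (rule that; assumption)
  \<comment> \<open>Periodicity and continuity make these bounds global, so \<open>BR + BL\<close>
    can serve as the time-independent constant \<open>M\<close>.\<close>
  obtain BR BL where BR: "\<And>x. \<bar>R (Suc (2 * m + 1)) x\<bar> \<le> BR" and BL: "\<And>x. \<bar>L (Suc (2 * m + 1)) x\<bar> \<le> BL"
    using continuous_periodic_2pi_bounded[OF cont(1) perR] continuous_periodic_2pi_bounded[OF cont(2) perL]
    by blast
  have M: "BR + BL \<ge> 0" using BR[of 0] BL[of 0] by linarith
  define U where "U = wave_jet c u R L"
  have U0: "U 0 x t = u x t" and USuc: "U (Suc i) x t = (R i (x + c * t) - L i (x - c * t)) / (2 * c)" for i x t
    by (simp_all add: U_def wave_jet_def)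
  have U_DERIV: "((\<lambda>y. U j y t) has_real_derivative U (Suc j) x t) (at x)"
    if "t \<ge> 0" "j \<le> 2 * m + 2" for j x t
  proof (cases j)
    case 0
    then show ?thesis using ux[OF that(1)] by (simp add: U0 USuc)
  next
    case (Suc i)
    have "((\<lambda>y. R i (y + c * t)) has_real_derivative R (Suc i) (x + c * t)) (at x)"
      using R[of i "x + c * t"] that Suc by (simp add: DERIV_shift)
    moreover have "((\<lambda>y. L i (y - c * t)) has_real_derivative L (Suc i) (x - c * t)) (at x)"
      using L[of i "x - c * t"] that Suc DERIV_shift[of "L i" _ x "- c * t"] by simp
    ultimately show ?thesis
      unfolding Suc USuc by (intro DERIV_cdivide DERIV_diff)
  qed
  have U_periodic: "periodic_2pi (\<lambda>x. U j x t)" if "t \<ge> 0" "j \<le> 2 * m + 2" for j t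
  proof (cases j)
    case 0
    then show ?thesis using per that by (simp add: U0)
  next
    case (Suc i)
    have "R i (x + 2 * pi + c * t) = R i (x + c * t)" "L i (x + 2 * pi - c * t) = L i (x - c * t)" for x
      using perR[of i, unfolded periodic_2pi_def, rule_format, of "x + c * t"]
        perL[of i, unfolded periodic_2pi_def, rule_format, of "x - c * t"] that Suc
      by (simp_all add: algebra_simps)
    then show ?thesis unfolding Suc USuc periodic_2pi_def by simp
  qed
  have U_dalembert: "U j x (t + s) + U j x (t - s) = U j (x + c * s) t + U j (x - c * s) t"
    if "0 \<le> s" "s \<le> t" for j x t s
  proof (cases j)
    case 0
    then show ?thesis using dalembert[OF that] by (simp add: U0)
  next
    case (Suc i)
    \<comment> \<open>For positive order \<open>U j\<close> is a sum of travelling waves, and the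
      identity is purely algebraic.\<close>
    show ?thesis unfolding Suc USuc using c by (simp add: field_simps)
  qed
  have U_lipschitz: "\<bar>U (2 * m + 2) x (t + s) - U (2 * m + 2) x (t - s)\<bar> \<le> (BR + BL) * s"
    if s: "0 \<le> s" "s \<le> t" for x t s
  proof -
    let ?i = "2 * m + 1"
    have "\<bar>R ?i (x + c * (t + s)) - R ?i (x + c * (t - s))\<bar> \<le> BR * \<bar>(x + c * (t + s)) - (x + c * (t - s))\<bar>"
      by (rule lipschitz_of_bounded_deriv[OF R BR]) simp
    moreover have "\<bar>L ?i (x - c * (t + s)) - L ?i (x - c * (t - s))\<bar> \<le> BL * \<bar>(x - c * (t + s)) - (x - c * (t - s))\<bar>"
      by (rule lipschitz_of_bounded_deriv[OF L BL]) simp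
    moreover have "\<bar>(x + c * (t + s)) - (x + c * (t - s))\<bar> = 2 * c * s"
      "\<bar>(x - c * (t + s)) - (x - c * (t - s))\<bar> = 2 * c * s"
      using mult_nonneg_nonneg[OF less_imp_le[OF c] s(1)] by (simp_all add: algebra_simps abs_if)
    ultimately have "\<bar>(R ?i (x + c * (t + s)) - L ?i (x - c * (t + s))) -
        (R ?i (x + c * (t - s)) - L ?i (x - c * (t - s)))\<bar> \<le> (BR + BL) * (2 * c * s)"
      by (simp add: distrib_right)
    then have "\<bar>(R ?i (x + c * (t + s)) - L ?i (x - c * (t + s))) -
        (R ?i (x + c * (t - s)) - L ?i (x - c * (t - s)))\<bar> / (2 * c) \<le> (BR + BL) * s"
      using c by (simp add: pos_divide_le_eq mult_ac)
    moreover have "2 * m + 2 = Suc ?i" by simp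
    ultimately show ?thesis
      unfolding \<open>2 * m + 2 = Suc ?i\<close> USuc using c by (simp add: diff_divide_distrib[symmetric])
  qed
  define \<kappa> \<mu> where "\<kappa> = 2 * c / \<eta>" and "\<mu> = sqrt (2 * pi) * (BR + BL) / (2 * c)"
  \<comment> \<open>The constant is fixed before mesh, time step and approximation are introduced.
    The absolute value makes the square root meaningful for any real \<open>C0\<close>.\<close>
  let ?C = "2 * pi * \<bar>C0\<bar> + 2 * \<bar>C0\<bar> * \<kappa> + 2 * sqrt \<bar>C0\<bar> * \<kappa>\<^sup>2 + 4 * \<mu> * \<kappa> ^ 3"
  show "\<exists>C::real. \<forall>(nx::nat) (h::real) (dt::real) (p::nat \<Rightarrow> real \<Rightarrow> real).
       nx \<ge> 1 \<longrightarrow> h = 2 * pi / real nx \<longrightarrow> \<eta> * h / c \<le> dt \<longrightarrow> c * dt < h \<longrightarrow>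
       conservative_hermite m c h dt p \<longrightarrow>
       l2norm (err u dt p 0) \<le> C0 * h ^ (2 * m + 1) \<longrightarrow>
       l2norm (err u dt p 1) \<le> C0 * h ^ (2 * m + 1) \<longrightarrow>
       err_energy (m + 1) u c dt p 1 \<le> C0 * h ^ (2 * m + 2) \<longrightarrow>
       (\<forall>k. l2norm (err u dt p k) \<le> C * h ^ (2 * m) * (1 + time_level dt k ^ 3))"
  proof (intro exI[of _ ?C] allI impI)
    fix nx :: nat and h dt :: real and p :: "nat \<Rightarrow> real \<Rightarrow> real" and k :: nat
    assume nx: "nx \<ge> 1" and h: "h = 2 * pi / real nx" and cfl: "\<eta> * h / c \<le> dt" "c * dt < h"
      and scheme: "conservative_hermite m c h dt p"
      and init: "l2norm (err u dt p 0) \<le> C0 * h ^ (2 * m + 1)"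
        "l2norm (err u dt p 1) \<le> C0 * h ^ (2 * m + 1)"
        "err_energy (m + 1) u c dt p 1 \<le> C0 * h ^ (2 * m + 2)"
    obtain f0 f1 where f: "periodic_2pi f0" "periodic_2pi f1"
      "p 0 = hermite_interp m h 0 f0" "p 1 = hermite_interp m h 1 f1"
      using scheme unfolding conservative_hermite_def hermite_range_def by blast
    interpret mesh nx h using nx h by unfold_locales
    have "dt > 0" using cfl(1) h_pos c \<eta> by (smt (verit) divide_pos_pos mult_pos_pos)
    interpret hermite_error nx h m c dt "BR + BL" U f0 f1
    proof
      show "continuous_on UNIV (\<lambda>x. U (2 * m + 2) x t)" if "t \<ge> 0" for t
        using U_DERIV[OF that, of "2 * m + 2"]
        by (auto intro!: continuous_at_imp_continuous_on DERIV_isCont)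
    qed (use \<open>dt > 0\<close> M f U_DERIV U_periodic U_dalembert U_lipschitz in auto)
    have P: "P k 0 = p k" for k
      unfolding P_def
      by (rule scheme_jet_0[OF f(3,4)])
        (use scheme in \<open>simp add: conservative_hermite_def shift_plus_def shift_minus_def \<sigma>_def\<close>)
    have e: "e k 0 = err u dt p k" for k
      by (rule ext) (simp add: e_def err_def U0 P)
    have N_e: "N (e k 0) = l2norm (err u dt p k)" for k
      using l2norm_jet[OF jet_e] e by simp
    \<comment> \<open>The shifted index 0 is level 1, that is time index 1/2, where the initial
      energy is prescribed.\<close>
    have Ep: "Ep 0 0 = cerr_plus u c dt p 1" and Em: "Em 0 0 = cerr_minus u c dt p 1"
      by (simp_all add: fun_eq_iff Ep_def Em_def cerr_plus_def cerr_minus_def e shift_plus_def shift_minus_def \<sigma>_def)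
    have "a 0 = sqrt (err_energy (m + 1) u c dt p 1)"
      using seminorm_jet[OF jet_Ep, of 0] seminorm_jet[OF jet_Em, of 0]
      by (simp add: a_def err_energy_def Ep Em)
    also have "\<dots> \<le> sqrt (\<bar>C0\<bar> * (h ^ Suc m)\<^sup>2)"
    proof -
      have "err_energy (m + 1) u c dt p 1 \<le> C0 * (h ^ Suc m)\<^sup>2"
        using init(3) unfolding power_mult[symmetric] by (simp add: mult.commute[of 2])
      also have "\<dots> \<le> \<bar>C0\<bar> * (h ^ Suc m)\<^sup>2" by (intro mult_right_mono) auto
      finally show ?thesis by simp
    qed
    also have "\<dots> = sqrt \<bar>C0\<bar> * h ^ Suc m"
      using h_pos by (simp add: real_sqrt_mult)
    finally have a0: "a 0 \<le> sqrt \<bar>C0\<bar> * h ^ Suc m" .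
    have "C0 * h ^ (2 * m + 1) \<le> \<bar>C0\<bar> * h ^ (2 * m + 1)"
      using h_pos by (intro mult_right_mono) auto
    then have e01: "N (e 0 0) \<le> \<bar>C0\<bar> * h ^ (2 * m + 1)" "N (e 1 0) \<le> \<bar>C0\<bar> * h ^ (2 * m + 1)"
      using init(1,2) N_e by (auto simp del: power_Suc)
    \<comment> \<open>The initial energy controls order m + 1 only; at order 0 the starting value of
      \<open>Ep\<close> is bounded by the two initial errors, hence the factor 2.\<close>
    have "N (Ep 0 0) \<le> N (e 1 0) + N (\<lambda>x. e 0 0 (x + \<sigma>))"
      unfolding Ep_def[abs_def]
      using nrm_triangle_diff[OF meas(4) jet_loc_bdd_meas[OF jet_shift[OF jet_e]], of 0 0] by simp
    then have b0: "N (Ep 0 0) \<le> 2 * \<bar>C0\<bar> * h ^ (2 * m + 1)"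
      using N_shift[OF jet_e, of 0] e01 by simp
    have "h \<le> 2 * pi"
      unfolding h using nx by (simp add: divide_le_eq)
    from error_rate_arithmetic[OF h_pos this c \<eta> M abs_ge_zero cfl a0 b0 e01(1) r_def N_e_le refl \<kappa>_def \<mu>_def]
    show "l2norm (err u dt p k) \<le> ?C * h ^ (2 * m) * (1 + time_level dt k ^ 3)"
      unfolding N_e[symmetric] time_level_def .
  qed
qed

end
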